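(* Let $n\ge 1$, let $\mathcal F\subseteq 2^{[n]}$, and let $G=(V,E)=\mathrm{KG}(\mathcal F)$ be its Kneser graph; assume $G$ has no isolated vertices. Let $\mathsf K=\mathsf K(\mathcal F)=\{S\subseteq[n] : F\not\subseteq S \text{ for all } F\in\mathcal F\}$. Then $$\chi(G)\ \ge\ \operatorname{ind}\mathsf B(G)+2\ =\ \operatorname{ind}\mathsf L(G)+2\ \ge\ \operatorname{ind}\mathsf B_0(G)+1\ =\ \operatorname{ind}\Delta\Bigl((2^{[n]})^{*2}_\Delta\setminus \mathsf K^{*2}_\Delta\Bigr)+1\ \ge\ n-1-\operatorname{ind}\mathsf K^{*2}_\Delta,$$ and moreover (a) $n-1-\operatorname{ind}\mathsf K^{*2}_\Delta\ge d$ whenever $d$ is an integer for which there exist a convex polytope $P$ of dimension $n-d$ and an injective map $\varphi$ from $[n]$ to the vertex set of $P$ such that $\mathsf K$ is (via $\varphi$) a subcomplex of the boundary complex of $P$, i.e. for every $S\in\mathsf K$ the points $\varphi(S)$ are affinely independent, the geometric simplex $\mathrm{conv}\,\varphi(S)$ lies in the boundary of $P$, and these geometric simplices form a geometric simplicial complex (any two of them meet in a common face); (b) $n-1-\operatorname{ind}\mathsf K^{*2}_\Delta\ \ge\ n-1-\dim \mathsf K^{*2}_\Delta\ =\ \operatorname{cd}_2(\mathcal F)$. (No relation between the bound $d$ in (a) and $\operatorname{cd}_2(\mathcal F)$ is asserted.)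
   Context: Graphs are finite, simple, undirected; $\chi(G)$ is the chromatic number. For $\mathcal F\subseteq 2^{[n]}$ (where $[n]=\{1,\dots,n\}$), the Kneser graph $\mathrm{KG}(\mathcal F)$ has vertex set $\mathcal F$ and edges all pairs $\{F_1,F_2\}$ of disjoint sets of $\mathcal F$. For $A\subseteq V$, $\mathrm{CN}(A)=\{v\in V: \{a,v\}\in E \text{ for all } a\in A\}$ (common neighbours; $\mathrm{CN}(\emptyset)=V$). For disjoint $A',A''\subseteq V$, write $A'\uplus A''=(A'\times\{1\})\cup(A''\times\{2\})$ and say $G[A',A'']$ is complete if every vertex of $A'$ is adjacent to every vertex of $A''$. A simplicial complex is a finite nonempty family of sets closed under taking subsets; $\dim\mathsf K=\max\{|S|-1:S\in\mathsf K\}$. For a finite family $\mathcal S$ of sets, $\Delta\mathcal S$ denotes the order complex of the poset $(\mathcal S\setminus\{\emptyset\},\subseteq)$ (simplices are chains). Box complexes (vertex set $V\times[2]$): $\mathsf B(G)=\{A'\uplus A'' : A',A''\subseteq V,\ A'\cap A''=\emptyset,\ G[A',A'']\text{ complete},\ \mathrm{CN}(A')\ne\emptyset,\ \mathrm{CN}(A'')\ne\emptyset\}$ and $\mathsf B_0(G)=\{A'\uplus A'' : A',A''\subseteq V,\ A'\cap A''=\emptyset,\ G[A',A'']\text{ complete}\}$; both carry the $\mathbb Z_2$-action $(v,1)\leftrightarrow(v,2)$. Lovász complex: $\mathsf L(G)$ is the order complex of the poset, under inclusion, of all nonempty $A\subsetneq V$ with $\mathrm{CN}(\mathrm{CN}(A))=A$;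 its $\mathbb Z_2$-action is induced by $A\mapsto\mathrm{CN}(A)$. Deleted join: for a simplicial complex $\mathsf L$ on vertex set $W$, $\mathsf L^{*2}_\Delta=\{S_1\uplus S_2 : S_1,S_2\in\mathsf L,\ S_1\cap S_2=\emptyset\}$ on vertex set $W\times[2]$, with $\mathbb Z_2$-action swapping $(w,1)\leftrightarrow(w,2)$. Here $2^{[n]}$ is the full simplex on $[n]$, and $\Delta((2^{[n]})^{*2}_\Delta\setminus\mathsf K^{*2}_\Delta)$ carries the action induced by $B'\uplus B''\mapsto B''\uplus B'$. $\mathbb Z_2$-index: for a space $T$ with involution $\nu$, $\operatorname{ind}(T,\nu)=\min\{m\ge 0:\text{there is a continuous } f:T\to S^m \text{ with } f\circ\nu=-f\}$ ($\infty$ if none). For a simplicial complex with a simplicial involution, ind refers to its polyhedron with the affinely extended involution. $2$-colorability defect: $\operatorname{cd}_2(\mathcal F)$ is the minimum size of $Y\subseteq[n]$ such that the sets of $\mathcal F$ disjoint from $Y$ can be 2-colored, i.e. $[n]\setminus Y$ can be colored red/blue with no set of $\mathcal F$ disjoint from $Y$ entirely red or entirely blue.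
   Formalization: The family F is assumed nonempty and not to contain the empty set (otherwise the chain fails, or K is not a complex and cd_2 is undefined), and the index of the empty space is taken to be -1 instead of 0, since (b) fails otherwise, e.g. for n=2, F={{1},{2}}. *)

theory Defs
  imports "HOL-Analysis.Analysis"
begin

section \<open>Graphs\<close>

text \<open>A graph is a pair of a vertex set and a set of edges, each edge being a two-element set of
  vertices.\<close>

type_synonym 'a graph = "'a set \<times> 'a set set"

abbreviation verts :: "'a graph \<Rightarrow> 'a set" where "verts \<equiv> fst"
abbreviation edges :: "'a graph \<Rightarrow> 'a set set" where "edges \<equiv> snd"

definition no_isolated_vertices :: "'a graph \<Rightarrow> bool" where
  "no_isolated_vertices G \<longleftrightarrow> (\<forall>v\<in>verts G. \<exists>w\<in>verts G. {v, w} \<in> edges G)"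

definition chromatic_number :: "'a graph \<Rightarrow> nat" where
  "chromatic_number G =
     (LEAST k. \<exists>c :: 'a \<Rightarrow> nat. c ` verts G \<subseteq> {..<k} \<and>
        (\<forall>v\<in>verts G. \<forall>w\<in>verts G. {v, w} \<in> edges G \<longrightarrow> c v \<noteq> c w))"

definition kneser_graph :: "'a set set \<Rightarrow> 'a set graph" where
  "kneser_graph \<F> = (\<F>, {{A, B} | A B. A \<in> \<F> \<and> B \<in> \<F> \<and> A \<noteq> B \<and> A \<inter> B = {}})"

definition CN :: "'a graph \<Rightarrow> 'a set \<Rightarrow> 'a set" where
  "CN G A = {v \<in> verts G. \<forall>a\<in>A. {a, v} \<in> edges G}"

definition complete_between :: "'a graph \<Rightarrow> 'a set \<Rightarrow> 'a set \<Rightarrow> bool" where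
  "complete_between G A B \<longleftrightarrow> (\<forall>a\<in>A. \<forall>b\<in>B. {a, b} \<in> edges G)"


section \<open>Abstract simplicial complexes, their polyhedra and the index\<close>

text \<open>Abstract simplicial complexes are families of finite sets that are closed under subsets
  and contain the empty simplex.\<close>

definition complex_dim :: "'v set set \<Rightarrow> int" where
  "complex_dim K = Max ((\<lambda>S. int (card S) - 1) ` K)"

definition order_complex :: "'v set set \<Rightarrow> 'v set set set" where
  "order_complex \<S> = {C. finite C \<and> C \<subseteq> \<S> - {{}} \<and> chain\<^sub>\<subseteq> C}"

text \<open>Points of the polyhedron are given by barycentric coordinates. All complexes below are
  finite, so the topology of pointwise convergence of the coordinates is the usual one.\<close>

definition polyhedron_of :: "'v set set \<Rightarrow> ('v \<Rightarrow> real) topology" where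
  "polyhedron_of K = subtopology (powertop_real UNIV)
     {x. (\<forall>v. 0 \<le> x v) \<and> {v. x v \<noteq> 0} \<in> K \<and> (\<Sum>v | x v \<noteq> 0. x v) = 1}"

text \<open>The affine extension of a vertex map \<open>g\<close>: the weight of every vertex \<open>v\<close> is moved
  to \<open>g v\<close>.\<close>

definition affine_extension :: "('v \<Rightarrow> 'v) \<Rightarrow> ('v \<Rightarrow> real) \<Rightarrow> 'v \<Rightarrow> real" where
  "affine_extension g x = (\<lambda>w. \<Sum>v | x v \<noteq> 0 \<and> g v = w. x v)"

text \<open>The index takes the value \<open>\<infinity>\<close> if there is no equivariant map into any sphere (the infimum
  is then taken over the empty set). The empty space gets index \<open>-1\<close>, in accordance with
  the convention that the sphere of dimension \<open>-1\<close> is empty.\<close>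

definition z2_index :: "'a topology \<Rightarrow> ('a \<Rightarrow> 'a) \<Rightarrow> ereal" where
  "z2_index T \<nu> =
     (if topspace T = {} then -1
      else (INF m \<in> {m. \<exists>f. continuous_map T (nsphere m) f \<and> (\<forall>x\<in>topspace T. f (\<nu> x) = - f x)}.
              ereal (real m)))"

definition complex_index :: "'v set set \<Rightarrow> ('v \<Rightarrow> 'v) \<Rightarrow> ereal" where
  "complex_index K g = z2_index (polyhedron_of K) (affine_extension g)"


section \<open>Box complexes, Lovasz complex, deleted join\<close>

text \<open>The vertex set \<open>V \<times> [2]\<close> is represented by the disjoint sum \<open>V <+> V\<close>: the copies with
  second component 1 and 2 are the elements tagged by \<open>Inl\<close> and \<open>Inr\<close>.\<close>

definition swap_sides :: "'v + 'v \<Rightarrow> 'v + 'v" where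
  "swap_sides = case_sum Inr Inl"

definition box_complex :: "'a graph \<Rightarrow> ('a + 'a) set set" where
  "box_complex G = {A <+> B | A B. A \<subseteq> verts G \<and> B \<subseteq> verts G \<and> A \<inter> B = {} \<and>
     complete_between G A B \<and> CN G A \<noteq> {} \<and> CN G B \<noteq> {}}"

definition box_complex0 :: "'a graph \<Rightarrow> ('a + 'a) set set" where
  "box_complex0 G = {A <+> B | A B. A \<subseteq> verts G \<and> B \<subseteq> verts G \<and> A \<inter> B = {} \<and>
     complete_between G A B}"

definition lovasz_complex :: "'a graph \<Rightarrow> 'a set set set" where
  "lovasz_complex G = order_complex {A. A \<noteq> {} \<and> A \<subset> verts G \<and> CN G (CN G A) = A}"

definition deleted_join :: "'v set set \<Rightarrow> ('v + 'v) set set" where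
  "deleted_join L = {S <+> T | S T. S \<in> L \<and> T \<in> L \<and> S \<inter> T = {}}"


section \<open>The complex of a set family and the colorability defect\<close>

definition free_complex :: "nat \<Rightarrow> nat set set \<Rightarrow> nat set set" where
  "free_complex n \<F> = {S. S \<subseteq> {1..n} \<and> (\<forall>F\<in>\<F>. \<not> F \<subseteq> S)}"

definition cd2 :: "nat \<Rightarrow> nat set set \<Rightarrow> nat" where
  "cd2 n \<F> = (LEAST k. \<exists>Y \<subseteq> {1..n}. card Y = k \<and>
     (\<exists>red :: nat \<Rightarrow> bool. \<forall>F\<in>\<F>. F \<inter> Y = {} \<longrightarrow> \<not> (\<forall>i\<in>F. red i) \<and> \<not> (\<forall>i\<in>F. \<not> red i)))"

end

theory Submission
  imports Defs "HOL-Homology.Homology" "HOL-Library.Multiset"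
begin

text \<open>Every equivariant map below is built from one partition of unity. For a face \<open>A\<close> of a complex with
  vertex set \<open>V\<close>, the weight \<open>(\<Prod>u\<in>A. x u) * (\<Prod>u\<in>A. \<Prod>v\<in>V - A. max 0 (x u - x v))\<close> is continuous in \<open>x\<close>,
  and the faces of nonzero weight at \<open>x\<close> are superlevel sets of \<open>x\<close>, hence form a chain. Sending a face to a
  set of vertices of a second complex, so that chains are sent to simplices, therefore induces a map of
  polyhedra; this is barycentric subdivision followed by a simplicial map. If the faces are split into two
  invariant families, the polyhedron is covered by two invariant open sets and its index is at most the
  sum of their indices plus one. This gives \<open>ind B\<^sub>0 \<le> ind B + 1\<close> and Sarkaria's inequality, which also
  needs the Borsuk-Ulam theorem. A colouring, a rank function on the faces, and an embedding into
  the boundary of a polytope yield explicit odd maps into a Euclidean space that omit the origin.\<close>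

section \<open>The Borsuk-Ulam theorem\<close>

text \<open>Indices are compared only through equivariant maps, so an equality of indices is proved
  as two inequalities, one map for each. A subdivision is never built as a space: the faces of
  nonzero weight at a point form a chain, that is, a simplex of the subdivision. The Borsuk-Ulam
  theorem enters once, in the lower bound \<open>n - 1\<close> for the boundary of the
  cross-polytope; all other estimates construct a map. In its proof singular chains stand in for an
  antipodally symmetric triangulation of the sphere. The constants come from counting coordinates.
  Maps to spheres of dimension \<open>k\<close> and \<open>l\<close> have \<open>k + 1\<close> and
  \<open>l + 1\<close> coordinates, which together give a sphere of dimension
  \<open>k + l + 1\<close>; the value -1 for the empty space keeps this count correct when one piece
  is empty. The \<open>m + 1\<close> colour classes give \<open>m\<close> differences, hence a
  sphere of dimension \<open>m - 1\<close>, two less than the number of colours. An index may be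
  infinite, so arithmetic takes place in \<open>ereal\<close>, where the lower bound -1 keeps
  negative infinity away from the indices.\<close>

text \<open>An odd map \<open>S\<^sup>n \<rightarrow> S\<^sup>m\<close> labels the points of \<open>S\<^sup>n\<close> by signed coordinates. Since the homology of
  \<open>S\<^sup>n\<close> vanishes below \<open>n\<close>, there are singular chains \<open>c\<^sub>0, \<dots>, c\<^sub>n\<close> such that \<open>c\<^sub>0\<close> is a point and
  \<open>\<partial>c\<^sub>p\<^sub>+\<^sub>1 = c\<^sub>p \<plusminus> \<nu> c\<^sub>p\<close>. After a fine subdivision, Fan's count of simplices with alternating labels is odd
  on every \<open>c\<^sub>p\<close>, and an alternating \<open>n\<close>-simplex needs \<open>n + 1\<close> different coordinates.\<close>

primrec alternating :: "bool \<Rightarrow> nat list \<Rightarrow> bool" where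
  "alternating b [] \<longleftrightarrow> True"
| "alternating b (x # xs) \<longleftrightarrow> even x = b \<and> alternating (\<not> b) xs"

text \<open>The mod 2 core of Fan's lemma, with parity in the role of the sign. Deleting the head
  leaves the tail; deleting a later entry keeps the head, so it counts only if the head has parity
  \<open>b\<close>. In that case the induction hypothesis for \<open>\<not> b\<close> cancels the
  term for the tail starting with \<open>b\<close>.\<close>

lemma even_alternating_remove1:
  assumes "sorted xs"
  shows "even ((\<Sum>y\<leftarrow>xs. of_bool (alternating b (remove1 y xs))) + (of_bool (alternating b xs)
     + of_bool (alternating (\<not> b) xs)) :: int)"
  using assms
proof (induction xs arbitrary: b)
  case (Cons x xs)
  \<comment> \<open>If \<open>y = x\<close>, sortedness puts a second copy of \<open>x\<close> right
    behind the head, and deleting either copy gives the same list.\<close>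
  have rem: "remove1 y (x # xs) = x # remove1 y xs" if y: "y \<in> set xs" for y
  proof (cases "y = x")
    case True
    then obtain z zs where zs: "xs = z # zs" using y by (cases xs) auto
    with True Cons.prems y have "z = x" by force
    with True zs show ?thesis by simp
  qed auto
  have "map (\<lambda>y. of_bool (alternating b (remove1 y (x # xs))) :: int) xs =
     map (\<lambda>y. of_bool (even x = b) * of_bool (alternating (\<not> b) (remove1 y xs))) xs"
    by (rule map_cong) (simp_all add: rem del: remove1.simps)
  from arg_cong[where f = sum_list, OF this] have "(\<Sum>y\<leftarrow>x # xs. of_bool (alternating b (remove1 y (x # xs)))) =
     of_bool (alternating b xs) + (\<Sum>y\<leftarrow>xs. of_bool (even x = b) * of_bool (alternating (\<not> b) (remove1 y xs)) :: int)"
    unfolding list.map sum_list.Cons by simp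
  also have "\<dots> = of_bool (alternating b xs) + of_bool (even x = b) * (\<Sum>y\<leftarrow>xs. of_bool (alternating (\<not> b) (remove1 y xs)))"
    by (simp add: sum_list_const_mult)
  finally have eq: "(\<Sum>y\<leftarrow>x # xs. of_bool (alternating b (remove1 y (x # xs)))) =
     (of_bool (alternating b xs) + of_bool (even x = b) * (\<Sum>y\<leftarrow>xs. of_bool (alternating (\<not> b) (remove1 y xs))) :: int)" .
  show ?case
    unfolding eq using Cons.IH[of "\<not> b"] Cons.prems by (cases "even x = b") auto
qed auto

text \<open>The label \<open>2 * j + s\<close> with \<open>s \<in> {0, 1}\<close> encodes the signed index \<open>\<plusminus>j\<close> of Fan's lemma.\<close>

definition complementary :: "nat \<Rightarrow> nat \<Rightarrow> bool" where
  "complementary x y \<longleftrightarrow> x div 2 = y div 2 \<and> x \<noteq> y"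

definition flip_label :: "nat \<Rightarrow> nat" where
  "flip_label x = (if even x then Suc x else x - 1)"

lemma even_flip_label [simp]: "even (flip_label x) \<longleftrightarrow> odd x"
  by (auto simp: flip_label_def)

lemma alternating_map_flip_label: "alternating b (map flip_label xs) = alternating (\<not> b) xs"
  by (induction xs arbitrary: b) auto

text \<open>A flip moves a label only inside its pair \<open>{2 * j, 2 * j + 1}\<close>, so labels
  of different index keep their order; labels of equal index that are not complementary
  coincide.\<close>

lemma flip_label_mono:
  assumes "x \<le> y" "\<not> complementary x y"
  shows "flip_label x \<le> flip_label y"
proof (cases "x div 2 = y div 2")
  case False
  with assms(1) have "x div 2 < y div 2" by (simp add: div_le_mono le_neq_implies_less)
  moreover have "flip_label z div 2 = z div 2" for z by (auto simp: flip_label_def elim!: oddE)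
  ultimately have "flip_label x div 2 < flip_label y div 2" by simp
  then show ?thesis by (meson div_le_mono leD linorder_le_cases)
qed (use assms in \<open>simp add: complementary_def\<close>)

text \<open>Vertices of a singular simplex may share a label, and Fan's condition ignores the order
  of the vertices; hence multisets.\<close>

definition alternating_mset :: "bool \<Rightarrow> nat multiset \<Rightarrow> bool" where
  "alternating_mset b M = alternating b (sorted_list_of_multiset M)"

lemma even_alternating_mset_diff:
  "even ((\<Sum>y\<in>#M. of_bool (alternating_mset b (M - {#y#}))) + (of_bool (alternating_mset b M)
     + of_bool (alternating_mset (\<not> b) M)) :: int)"
proof -
  define xs where "xs = sorted_list_of_multiset M"
  have M: "M = mset xs" by (simp add: xs_def)
  have s: "sorted xs" by (simp add: xs_def)
  have "sorted_list_of_multiset (M - {#y#}) = remove1 y xs" for y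
    using s by (simp add: M sorted_remove1 sorted_sort_id flip: mset_remove1)
  then have "(\<Sum>y\<in>#M. of_bool (alternating_mset b (M - {#y#})) :: int)
      = (\<Sum>y\<leftarrow>xs. of_bool (alternating b (remove1 y xs)))"
    unfolding alternating_mset_def by (simp add: M sum_mset_sum_list flip: mset_map)
  with even_alternating_remove1[OF s, of b] show ?thesis
    by (simp add: alternating_mset_def xs_def)
qed

lemma alternating_mset_flip_label:
  assumes "\<And>x y. x \<in># M \<Longrightarrow> y \<in># M \<Longrightarrow> \<not> complementary x y"
  shows "alternating_mset b (image_mset flip_label M) = alternating_mset (\<not> b) M"
proof -
  define xs where "xs = sorted_list_of_multiset M"
  have M: "M = mset xs" and s: "sorted xs" by (simp_all add: xs_def)
  have "sorted (map flip_label xs)"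
    unfolding sorted_map
    by (rule sorted_wrt_mono_rel[OF _ s]) (use assms M in \<open>auto intro: flip_label_mono\<close>)
  then have "sorted_list_of_multiset (image_mset flip_label M) = map flip_label xs"
    by (simp add: M sorted_sort_id flip: mset_map)
  then show ?thesis
    by (simp add: alternating_mset_def alternating_map_flip_label flip: xs_def)
qed

text \<open>Entries of equal index are neighbours after sorting. Without complementary pairs they
  are equal labels, and equal neighbours violate alternation.\<close>

lemma alternating_imp_distinct_div:
  assumes "alternating b xs" "sorted xs" "\<And>x y. x \<in> set xs \<Longrightarrow> y \<in> set xs \<Longrightarrow> \<not> complementary x y"
  shows "distinct (map (\<lambda>x. x div 2) xs)"
  using assms
proof (induction xs arbitrary: b)
  case (Cons x xs)
  have "x div 2 \<noteq> y div 2" if y: "y \<in> set xs" for y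
  proof
    assume eq: "x div 2 = y div 2"
    obtain z zs where xs: "xs = z # zs" using y by (cases xs) auto
    then have "x \<noteq> z" using Cons.prems(1) by auto
    have "x \<le> z" "z \<le> y" using Cons.prems(2) y xs by auto
    then have "z div 2 = x div 2" using eq by (metis div_le_mono order_antisym)
    then have "complementary x z" using \<open>x \<noteq> z\<close> by (simp add: complementary_def)
    then show False using Cons.prems(3) xs by auto
  qed
  moreover have "distinct (map (\<lambda>x. x div 2) xs)"
    using Cons by (intro Cons.IH) auto
  ultimately show ?case by auto
qed auto

lemma alternating_mset_size_le:
  assumes "alternating_mset b M" "\<And>x y. x \<in># M \<Longrightarrow> y \<in># M \<Longrightarrow> \<not> complementary x y"
    and "\<And>x. x \<in># M \<Longrightarrow> x div 2 \<le> m"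
  shows "size M \<le> Suc m"
proof -
  define xs where "xs = sorted_list_of_multiset M"
  have M: "M = mset xs" and s: "sorted xs" by (simp_all add: xs_def)
  have "distinct (map (\<lambda>x. x div 2) xs)"
    by (rule alternating_imp_distinct_div[of b])
      (use assms s M in \<open>auto simp: alternating_mset_def sorted_sort_id\<close>)
  then have "length xs = card (set (map (\<lambda>x. x div 2) xs))"
    by (metis distinct_card length_map)
  also have "\<dots> \<le> card {..m}"
    by (rule card_mono) (use assms(3) M in auto)
  finally show ?thesis by (simp add: M)
qed

text \<open>The pairing of a cochain with a chain. The values are collected in the free abelian
  group on one generator and read off as its coefficient, so linearity is inherited from
  \<open>frag_extend\<close>.\<close>

definition chain_eval :: "('a \<Rightarrow> int) \<Rightarrow> ('a \<Rightarrow>\<^sub>0 int) \<Rightarrow> int" where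
  "chain_eval \<phi> c = poly_mapping.lookup (frag_extend (\<lambda>\<sigma>. frag_cmul (\<phi> \<sigma>) (frag_of ())) c) ()"

lemma chain_eval_0 [simp]: "chain_eval \<phi> 0 = 0"
  by (simp add: chain_eval_def)

lemma chain_eval_of [simp]: "chain_eval \<phi> (frag_of \<sigma>) = \<phi> \<sigma>"
  by (simp add: chain_eval_def)

lemma chain_eval_diff [simp]: "chain_eval \<phi> (a - b) = chain_eval \<phi> a - chain_eval \<phi> b"
  by (simp add: chain_eval_def frag_extend_diff lookup_minus)

lemma chain_eval_add [simp]: "chain_eval \<phi> (a + b) = chain_eval \<phi> a + chain_eval \<phi> b"
  by (simp add: chain_eval_def frag_extend_add lookup_add)

lemma chain_eval_cmul [simp]: "chain_eval \<phi> (frag_cmul k a) = k * chain_eval \<phi> a"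
  by (simp add: chain_eval_def frag_extend_cmul)

lemma chain_eval_sum: "finite I \<Longrightarrow> chain_eval \<phi> (\<Sum>i\<in>I. f i) = (\<Sum>i\<in>I. chain_eval \<phi> (f i))"
  by (induction I rule: finite_induct) auto

lemma chain_eval_nonzero:
  assumes "chain_eval \<phi> c \<noteq> 0"
  obtains \<sigma> where "\<sigma> \<in> Poly_Mapping.keys c" "\<phi> \<sigma> \<noteq> 0"
proof (rule ccontr)
  assume "\<not> thesis"
  then have "frag_extend (\<lambda>\<sigma>. frag_cmul (\<phi> \<sigma>) (frag_of ())) c = 0"
    using that by (intro frag_extend_eq_0) auto
  then show False using assms by (simp add: chain_eval_def)
qed

definition simplex_labels :: "('a \<Rightarrow> nat) \<Rightarrow> nat \<Rightarrow> ((nat \<Rightarrow> real) \<Rightarrow> 'a) \<Rightarrow> nat multiset" where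
  "simplex_labels lab p \<sigma> = {#lab (\<sigma> (\<lambda>j. if j = i then 1 else 0)). i \<in># mset_set {..p}#}"

lemma simplex_labels_singular_face:
  assumes "k \<le> Suc q"
  shows "simplex_labels lab q (singular_face (Suc q) k \<sigma>) =
    simplex_labels lab (Suc q) \<sigma> - {#lab (\<sigma> (\<lambda>j. if j = k then 1 else 0))#}"
proof -
  \<comment> \<open>The coface map: the \<open>k\<close>-th face has the vertices \<open>s i\<close>
    in order, with vertex \<open>k\<close> skipped.\<close>
  define s where "s i = (if i < k then i else Suc i)" for i
  have face: "singular_face (Suc q) k \<sigma> (\<lambda>j. if j = i then 1 else 0) = \<sigma> (\<lambda>j. if j = s i then 1 else 0)"
    if "i \<le> q" for i
  proof -
    have "simplical_face k (\<lambda>j. if j = i then 1 else 0 :: real) = (\<lambda>j. if j = s i then 1 else 0)"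
      by (rule ext) (auto simp: simplical_face_def s_def)
    then show ?thesis
      using that by (simp add: singular_face_def)
  qed
  have "inj_on s {..q}" by (auto simp: inj_on_def s_def split: if_splits)
  moreover have "s ` {..q} = {..Suc q} - {k}"
  proof -
    have "x \<in> s ` {..q}" if "x \<in> {..Suc q} - {k}" for x
      using that assms
      by (cases "x < k") (force simp: s_def, cases x, auto simp: s_def image_iff)
    then show ?thesis by (auto simp: s_def split: if_splits)
  qed
  ultimately have s: "image_mset s (mset_set {..q}) = mset_set ({..Suc q} - {k})"
    by (simp add: image_mset_mset_set)
  have "simplex_labels lab q (singular_face (Suc q) k \<sigma>) =
     {#lab (\<sigma> (\<lambda>j. if j = s i then 1 else 0)). i \<in># mset_set {..q}#}"
    unfolding simplex_labels_def by (rule image_mset_cong) (simp add: face)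
  also have "\<dots> = {#lab (\<sigma> (\<lambda>j. if j = i then 1 else 0)). i \<in># image_mset s (mset_set {..q})#}"
    by (simp add: multiset.map_comp o_def)
  also have "\<dots> = simplex_labels lab (Suc q) \<sigma> - {#lab (\<sigma> (\<lambda>j. if j = k then 1 else 0))#}"
    using assms unfolding s simplex_labels_def
    by (subst mset_set.remove[of "{..Suc q}" k]) (auto simp del: atMost_Suc)
  finally show ?thesis .
qed

definition fan_cochain :: "('a \<Rightarrow> nat) \<Rightarrow> nat \<Rightarrow> bool \<Rightarrow> ((nat \<Rightarrow> real) \<Rightarrow> 'a) \<Rightarrow> int" where
  "fan_cochain lab p b \<sigma> = of_bool (alternating_mset b (simplex_labels lab p \<sigma>))"

text \<open>The signs of the boundary vanish modulo 2, and each face of a simplex deletes one label.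
  So, modulo 2, the coboundary of Fan's cochain in degree \<open>q\<close> is the sum of both
  cochains in degree \<open>Suc q\<close>.\<close>

lemma fan_cochain_boundary:
  "even (chain_eval (fan_cochain lab q b) (chain_boundary (Suc q) c)
     + (chain_eval (fan_cochain lab (Suc q) b) c + chain_eval (fan_cochain lab (Suc q) (\<not> b)) c))"
proof (induction c rule: frag_induction[OF subset_UNIV])
  case (2 \<sigma>)
  define M where "M = simplex_labels lab (Suc q) \<sigma>"
  have "even ((\<Sum>k\<le>Suc q. (- 1) ^ k * fan_cochain lab q b (singular_face (Suc q) k \<sigma>))
      + (\<Sum>k\<le>Suc q. fan_cochain lab q b (singular_face (Suc q) k \<sigma>)))"
    unfolding sum.distrib[symmetric]
    by (rule dvd_sum) (auto simp: minus_one_power_iff)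
  moreover have "(\<Sum>k\<le>Suc q. fan_cochain lab q b (singular_face (Suc q) k \<sigma>)) =
     (\<Sum>k\<le>Suc q. of_bool (alternating_mset b (M - {#lab (\<sigma> (\<lambda>j. if j = k then 1 else 0))#})))"
    by (rule sum.cong) (simp_all add: fan_cochain_def simplex_labels_singular_face M_def)
  also have "\<dots> = (\<Sum>y\<in>#M. of_bool (alternating_mset b (M - {#y#})))"
    unfolding sum_unfold_sum_mset
    by (subst (3) M_def) (simp add: simplex_labels_def multiset.map_comp o_def del: atMost_Suc)
  finally have "even ((\<Sum>k\<le>Suc q. (- 1) ^ k * fan_cochain lab q b (singular_face (Suc q) k \<sigma>))
      + (\<Sum>y\<in>#M. of_bool (alternating_mset b (M - {#y#}))))" .
  with even_alternating_mset_diff[of b M] show ?case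
    by (auto simp: chain_boundary_of chain_eval_sum fan_cochain_def M_def simp del: sum.atMost_Suc)
qed (auto simp: chain_boundary_diff)

text \<open>The antipode flips every label. On a simplex without complementary labels this keeps the
  sorted order and reverses all parities, so only the starting parity changes.\<close>

lemma fan_cochain_antipodal:
  assumes lab: "\<And>x. x \<in> topspace X \<Longrightarrow> lab (\<nu> x) = flip_label (lab x)"
    and c: "singular_chain p X c"
    and nc: "\<And>\<sigma> x y. \<sigma> \<in> Poly_Mapping.keys c \<Longrightarrow> x \<in># simplex_labels lab p \<sigma> \<Longrightarrow>
       y \<in># simplex_labels lab p \<sigma> \<Longrightarrow> \<not> complementary x y"
  shows "chain_eval (fan_cochain lab p b) (chain_map p \<nu> c) = chain_eval (fan_cochain lab p (\<not> b)) c"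
proof -
  define S where "S = Poly_Mapping.keys c"
  have S: "\<sigma> \<in> S \<Longrightarrow> singular_simplex p X \<sigma>" for \<sigma>
    using c by (auto simp: S_def singular_chain_def)
  have "Poly_Mapping.keys c \<subseteq> S" by (simp add: S_def)
  then show ?thesis
  proof (induction c rule: frag_induction)
    case (one \<sigma>)
    have "\<sigma> (\<lambda>j. if j = i then 1 else 0) \<in> topspace X" if "i \<le> p" for i
      using S[OF one] that unfolding singular_simplex_def continuous_map_def
      by (force simp: Pi_iff)
    then have "simplex_labels lab p (simplex_map p \<nu> \<sigma>) = image_mset flip_label (simplex_labels lab p \<sigma>)"
      by (auto simp: simplex_labels_def multiset.map_comp simplex_map_def lab intro!: image_mset_cong)
    moreover have "alternating_mset b (image_mset flip_label (simplex_labels lab p \<sigma>)) = alternating_mset (\<not> b) (simplex_labels lab p \<sigma>)"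
      by (rule alternating_mset_flip_label) (use nc one S_def in auto)
    ultimately show ?case by (simp add: fan_cochain_def)
  qed (auto simp: chain_map_diff)
qed

section \<open>Iterated subdivision and the filling of antipodal cycles in the sphere\<close>

lemma chain_boundary_iterated_subdivision:
  "singular_chain p X c \<Longrightarrow> chain_boundary p ((singular_subdivision p ^^ N) c)
     = (singular_subdivision (p - Suc 0) ^^ N) (chain_boundary p c)"
  and singular_chain_iterated_subdivision:
  "singular_chain p X c \<Longrightarrow> singular_chain p X ((singular_subdivision p ^^ N) c)"
  by (induction N) (auto simp: chain_boundary_singular_subdivision singular_chain_singular_subdivision)

lemma naturality_iterated_subdivision:
  "singular_chain p X c \<Longrightarrow> (singular_subdivision p ^^ N) (chain_map p g c)
     = chain_map p g ((singular_subdivision p ^^ N) c)"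
  by (induction N)
    (auto simp: naturality_singular_subdivision[where X = X] singular_chain_iterated_subdivision)

lemma iterated_subdivision_add:
  "(singular_subdivision p ^^ N) (a + b) = (singular_subdivision p ^^ N) a + (singular_subdivision p ^^ N) b"
  by (induction N) (auto simp: singular_subdivision_add)

lemma iterated_subdivision_cmul:
  "(singular_subdivision p ^^ N) (frag_cmul k a) = frag_cmul k ((singular_subdivision p ^^ N) a)"
  by (induction N) (auto simp: singular_subdivision_def frag_extend_cmul)

lemma iterated_subdivision_zero:
  "singular_chain 0 X c \<Longrightarrow> (singular_subdivision 0 ^^ N) c = c"
  by (induction N) (auto simp: singular_subdivision_zero)

text \<open>In degree 0 the reduced group is the kernel of the map induced by the projection to a
  point; \<open>aug\<close> puts the class there already at the level of chains.\<close>

lemma reduced_cycle_imp_boundary: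
  assumes triv: "trivial_group (reduced_homology_group (int p) X)"
    and z: "singular_relcycle p X {} z" and aug: "p = 0 \<Longrightarrow> chain_map p (\<lambda>_. ()) z = 0"
  shows "singular_relboundary p X {} z"
proof -
  have "homologous_rel_set p X {} z \<in> carrier (reduced_homology_group (int p) X)"
  proof (cases "p = 0")
    case True
    show ?thesis
      unfolding carrier_reduced_homology_group kernel_def
      using z aug[OF True]
      by (auto simp: carrier_relative_homology_group hom_induced_chain_map homologous_rel_set_eq_relboundary)
  next
    case False
    then show ?thesis
      using z by (auto simp: un_reduced_homology_group carrier_relative_homology_group)
  qed
  then have "homologous_rel_set p X {} z = singular_relboundary_set p X {}"
    using triv by (auto simp: trivial_group_def one_reduced_homology_group)
  then show ?thesis by (simp add: homologous_rel_set_eq_relboundary)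
qed

text \<open>The chains \<open>c p\<close> play the part of hemispheres in the antipodal cell
  structure. The sign \<open>(- 1) ^ Suc p\<close> makes \<open>c p\<close> plus its signed image a
  cycle, because \<open>\<nu>\<close> is an involution and the terms of the previous stage cancel;
  for \<open>p = 0\<close> it is -1, so the augmentation vanishes.\<close>

lemma nsphere_antipodal_cells:
  fixes \<nu> :: "(nat \<Rightarrow> real) \<Rightarrow> (nat \<Rightarrow> real)"
  assumes \<nu>: "continuous_map (nsphere n) (nsphere n) \<nu>"
    and inv: "\<And>x. x \<in> topspace (nsphere n) \<Longrightarrow> \<nu> (\<nu> x) = x"
  obtains c where "\<And>p. p \<le> n \<Longrightarrow> singular_chain p (nsphere n) (c p)"
    "\<And>p. p < n \<Longrightarrow> chain_boundary (Suc p) (c (Suc p)) =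
       c p + frag_cmul ((- 1) ^ Suc p) (chain_map p \<nu> (c p))"
    "\<exists>\<sigma>. c 0 = frag_of \<sigma>"
proof -
  let ?X = "nsphere n"
  define ok where "ok k c \<longleftrightarrow> (\<forall>p\<le>k. singular_chain p ?X (c p)) \<and> (\<exists>\<sigma>. c 0 = frag_of \<sigma>) \<and>
     (\<forall>p<k. chain_boundary (Suc p) (c (Suc p)) = c p + frag_cmul ((- 1) ^ Suc p) (chain_map p \<nu> (c p)))"
    for k and c :: "nat \<Rightarrow> (nat \<Rightarrow> real) chain"
  have "\<exists>c. ok k c" if "k \<le> n" for k
    using that
  proof (induction k)
    case 0
    obtain x0 where x0: "x0 \<in> topspace ?X" using in_topspace_nsphere by blast
    define \<sigma> where "\<sigma> = restrict (\<lambda>_. x0) (standard_simplex 0)"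
    have "continuous_map (subtopology (powertop_real UNIV) (standard_simplex 0)) ?X \<sigma>"
      by (rule continuous_map_eq[of _ _ "\<lambda>_. x0"]) (use x0 in \<open>auto simp: \<sigma>_def\<close>)
    then have "singular_simplex 0 ?X \<sigma>"
      by (simp add: singular_simplex_def \<sigma>_def)
    then show ?case
      by (intro exI[of _ "\<lambda>_. frag_of \<sigma>"]) (auto simp: ok_def singular_chain_of)
  next
    case (Suc k)
    then obtain c where c: "ok k c" by auto
    define z where "z = c k + frag_cmul ((- 1) ^ Suc k) (chain_map k \<nu> (c k))"
    have ck: "singular_chain k ?X (c k)" using c by (simp add: ok_def)
    have z: "singular_chain k ?X z"
      unfolding z_def using ck \<nu> by (intro singular_chain_add singular_chain_cmul singular_chain_chain_map)
    have twice: "chain_map p \<nu> (chain_map p \<nu> e) = e" if "singular_chain p ?X e" for p e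
      using chain_map_id_gen[OF that, of "\<nu> \<circ> \<nu>"] inv by (simp add: chain_map_compose)
    have "singular_relboundary k ?X {} z"
    proof (rule reduced_cycle_imp_boundary)
      show "trivial_group (reduced_homology_group (int k) ?X)"
        using Suc.prems by (simp add: trivial_reduced_homology_group_nsphere)
      have "chain_boundary k z = 0"
      proof (cases k)
        case (Suc j)
        have cj: "singular_chain j ?X (c j)"
          and b: "chain_boundary k (c k) = c j + frag_cmul ((- 1) ^ k) (chain_map j \<nu> (c j))"
          using c Suc by (auto simp: ok_def)
        show ?thesis
          unfolding z_def chain_boundary_add chain_boundary_cmul
          using chain_boundary_chain_map[OF ck, of \<nu>] b Suc
          by (cases "even j") (simp_all add: chain_map_add chain_map_diff chain_map_minus twice[OF cj])
      qed (simp add: chain_boundary_def)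
      with z show "singular_relcycle k ?X {} z" by (simp add: singular_cycle)
      show "chain_map k (\<lambda>_. ()) z = 0" if "k = 0"
        using fun_cong[OF chain_map_compose[of k "\<lambda>_. ()" \<nu>], of "c k"] that
        by (simp add: z_def chain_map_add chain_map_diff chain_map_minus o_def)
    qed
    then obtain d where d: "singular_chain (Suc k) ?X d" "chain_boundary (Suc k) d = z"
      by (auto simp: singular_boundary)
    then show ?case
      using c by (intro exI[of _ "c(Suc k := d)"]) (auto simp: ok_def z_def less_Suc_eq le_Suc_eq)
  qed
  then obtain c where "ok n c" by blast
  then show thesis by (intro that[of c]) (auto simp: ok_def)
qed


theorem Borsuk_Ulam_nsphere:
  assumes f: "continuous_map (nsphere n) (nsphere m) f"
    and odd: "\<And>x. x \<in> topspace (nsphere n) \<Longrightarrow> f (- x) = - f x"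
  shows "n \<le> m"
proof -
  let ?X = "nsphere n"
  have in_sphere: "(\<Sum>i\<le>m. (f x i)\<^sup>2) = 1" if "x \<in> topspace ?X" for x
    using continuous_map_image_subset_topspace[OF f] that by (auto simp: nsphere)
  define \<nu> where "\<nu> = (uminus :: (nat \<Rightarrow> real) \<Rightarrow> nat \<Rightarrow> real)"
  have top_\<nu>: "\<nu> x \<in> topspace ?X" if "x \<in> topspace ?X" for x
    using that by (auto simp: \<nu>_def nsphere)
  have \<nu>: "continuous_map ?X ?X \<nu>"
    unfolding nsphere \<nu>_def continuous_map_in_subtopology continuous_map_componentwise_UNIV
    by (auto simp: fun_Compl_def intro!: continuous_intros continuous_map_from_subtopology)
  \<comment> \<open>Among the \<open>m + 1\<close> coordinates of a unit vector, one has absolute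
    value at least \<open>r\<close>.\<close>
  define r where "r = 1 / sqrt (real (Suc m))"
  have r: "r > 0" "r\<^sup>2 = 1 / real (Suc m)" by (auto simp: r_def power_divide)
  define big where "big x j \<longleftrightarrow> j \<le> m \<and> \<bar>f x j\<bar> \<ge> r" for x j
  define ix where "ix x = (LEAST j. big x j)" for x
  \<comment> \<open>\<open>ix\<close> depends only on absolute values, so antipodal points share it
    and their labels differ only in the sign bit.\<close>
  define lab where "lab x = 2 * ix x + (if f x (ix x) > 0 then 0 else 1)" for x
  have big: "big x (ix x)" if x: "x \<in> topspace ?X" for x
  proof -
    have "\<exists>j\<le>m. (f x j)\<^sup>2 \<ge> r\<^sup>2"
    proof (rule ccontr)
      assume "\<not> ?thesis"
      then have "(\<Sum>j\<le>m. (f x j)\<^sup>2) < (\<Sum>j\<le>m. r\<^sup>2)"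
        by (intro sum_strict_mono) auto
      then show False using in_sphere[OF x] r by simp
    qed
    then show ?thesis
      unfolding ix_def big_def using r by (metis (mono_tags, lifting) LeastI_ex abs_le_square_iff abs_of_pos)
  qed
  have lab_div: "lab x div 2 = ix x" for x by (simp add: lab_def)
  have ix_\<nu>: "ix (\<nu> x) = ix x" if "x \<in> topspace ?X" for x
    using odd[OF that] by (simp add: ix_def big_def \<nu>_def)
  have lab_\<nu>: "lab (\<nu> x) = flip_label (lab x)" if x: "x \<in> topspace ?X" for x
    using big[OF x] odd[OF x] ix_\<nu>[OF x] r by (auto simp: lab_def flip_label_def big_def \<nu>_def)
  \<comment> \<open>One open set per sign pattern \<open>s\<close>. In \<open>U s\<close> each
    coordinate is bounded by \<open>r\<close> on one side, so it cannot be large with both signs,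
    and no two points of \<open>U s\<close> get complementary labels. The signs of
    \<open>f x\<close> give a pattern whose set contains \<open>x\<close>.\<close>
  define U where "U s = {x \<in> topspace ?X. \<forall>j\<in>{..m}. if s j then f x j > - r else f x j < r}" for s :: "nat \<Rightarrow> bool"
  have cf: "continuous_map ?X euclideanreal (\<lambda>x. f x j)" for j
    using f unfolding nsphere[of m] continuous_map_in_subtopology continuous_map_componentwise_UNIV by auto
  have U_nc: "\<not> complementary (lab x) (lab y)" if "x \<in> U s" "y \<in> U s" for x y s
  proof
    assume "complementary (lab x) (lab y)"
    then have eq: "ix x = ix y" and ne: "lab x \<noteq> lab y"
      by (auto simp: complementary_def lab_div)
    have "big x (ix x)" "big y (ix y)" using big that by (auto simp: U_def)
    then have "ix x \<in> {..m}" "r \<le> \<bar>f x (ix x)\<bar>" "r \<le> \<bar>f y (ix x)\<bar>"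
      using eq by (auto simp: big_def)
    moreover from this(1) have "if s (ix x) then f x (ix x) > - r else f x (ix x) < r"
      "if s (ix x) then f y (ix x) > - r else f y (ix x) < r"
      using that unfolding U_def by blast+
    ultimately have "f x (ix x) > 0 \<longleftrightarrow> s (ix x)" "f y (ix x) > 0 \<longleftrightarrow> s (ix x)"
      using r(1) by (auto split: if_splits)
    with ne eq show False by (simp add: lab_def)
  qed
  have U_open: "openin ?X (U s)" for s
  proof -
    have "openin ?X {x \<in> topspace ?X. f x j \<in> (if s j then {-r<..} else {..<r})}" for j
      by (rule openin_continuous_map_preimage[OF cf]) auto
    then have "openin ?X (topspace ?X \<inter> (\<Inter>j\<in>{..m}. {x \<in> topspace ?X. f x j \<in> (if s j then {-r<..} else {..<r})}))"
      by (intro openin_Int openin_topspace openin_INT) auto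
    also have "\<dots> = U s" by (auto simp: U_def split: if_splits)
    finally show ?thesis .
  qed
  have U_cover: "topspace ?X \<subseteq> \<Union>(range U)"
  proof
    fix x assume "x \<in> topspace ?X"
    then have "x \<in> U (\<lambda>j. f x j \<ge> 0)" using r by (auto simp: U_def)
    then show "x \<in> \<Union>(range U)" by blast
  qed
  obtain c where c: "\<And>p. p \<le> n \<Longrightarrow> singular_chain p ?X (c p)"
    and bdry: "\<And>p. p < n \<Longrightarrow> chain_boundary (Suc p) (c (Suc p)) =
       c p + frag_cmul ((- 1) ^ Suc p) (chain_map p \<nu> (c p))"
    and c0: "\<exists>\<sigma>. c 0 = frag_of \<sigma>"
    by (rule nsphere_antipodal_cells[OF \<nu>]) (auto simp: \<nu>_def)
  \<comment> \<open>The boundary relation links \<open>c p\<close> and \<open>c (Suc p)\<close>, so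
    one number of subdivisions has to serve all dimensions up to \<open>n\<close>.\<close>
  have "\<exists>N. \<forall>p\<le>k. \<forall>M\<ge>N. \<forall>\<sigma>\<in>Poly_Mapping.keys ((singular_subdivision p ^^ M) (c p)). \<exists>V\<in>range U. \<sigma> \<in> standard_simplex p \<rightarrow> V"
    if "k \<le> n" for k
    using that
  proof (induction k)
    case 0
    obtain N where "\<And>M \<sigma>. \<lbrakk>N \<le> M; \<sigma> \<in> Poly_Mapping.keys ((singular_subdivision 0 ^^ M) (c 0))\<rbrakk>
         \<Longrightarrow> \<exists>V \<in> range U. \<sigma> \<in> standard_simplex 0 \<rightarrow> V"
      using sufficient_iterated_singular_subdivision_exists[of "range U" ?X 0 "c 0"] U_open U_cover c[OF 0] by blast
    then show ?case by blast
  next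
    case (Suc k)
    obtain N where N: "\<And>M \<sigma>. \<lbrakk>N \<le> M; \<sigma> \<in> Poly_Mapping.keys ((singular_subdivision (Suc k) ^^ M) (c (Suc k)))\<rbrakk>
         \<Longrightarrow> \<exists>V \<in> range U. \<sigma> \<in> standard_simplex (Suc k) \<rightarrow> V"
      using sufficient_iterated_singular_subdivision_exists[of "range U" ?X "Suc k" "c (Suc k)"] U_open U_cover c[OF Suc.prems] by blast
    from Suc obtain N' where N': "\<forall>p\<le>k. \<forall>M\<ge>N'. \<forall>\<sigma>\<in>Poly_Mapping.keys ((singular_subdivision p ^^ M) (c p)). \<exists>V\<in>range U. \<sigma> \<in> standard_simplex p \<rightarrow> V"
      by auto
    show ?case
      by (rule exI[of _ "max N N'"]) (use N N' in \<open>auto simp: le_Suc_eq\<close>)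
  qed
  from this[of n] obtain N where N0: "\<forall>p\<le>n. \<forall>M\<ge>N. \<forall>\<sigma>\<in>Poly_Mapping.keys ((singular_subdivision p ^^ M) (c p)).
      \<exists>V\<in>range U. \<sigma> \<in> standard_simplex p \<rightarrow> V"
    by auto
  have N: "\<exists>s. \<sigma> \<in> standard_simplex p \<rightarrow> U s"
    if "p \<le> n" "\<sigma> \<in> Poly_Mapping.keys ((singular_subdivision p ^^ N) (c p))" for p \<sigma>
    using N0[rule_format, of p N \<sigma>] that by auto
  define d where "d p = (singular_subdivision p ^^ N) (c p)" for p
  have d: "singular_chain p ?X (d p)" if "p \<le> n" for p
    using c[OF that] by (simp add: d_def singular_chain_iterated_subdivision)
  have bdry_d: "chain_boundary (Suc p) (d (Suc p)) = d p + frag_cmul ((- 1) ^ Suc p) (chain_map p \<nu> (d p))"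
    if "p < n" for p
  proof -
    have "chain_boundary (Suc p) (d (Suc p)) = (singular_subdivision p ^^ N) (c p + frag_cmul ((- 1) ^ Suc p) (chain_map p \<nu> (c p)))"
      using chain_boundary_iterated_subdivision[of "Suc p" ?X "c (Suc p)" N] c[of "Suc p"] that
      by (simp add: d_def bdry)
    also have "\<dots> = d p + frag_cmul ((- 1) ^ Suc p) (chain_map p \<nu> (d p))"
      using that naturality_iterated_subdivision[OF c[of p], of N \<nu>]
      by (simp add: d_def iterated_subdivision_add iterated_subdivision_cmul)
    finally show ?thesis .
  qed
  have vertex: "\<exists>v\<in>standard_simplex p. x = lab (\<sigma> v)" if "x \<in># simplex_labels lab p \<sigma>" for x p \<sigma>
    using that by (auto simp: simplex_labels_def)
  have nc: "\<not> complementary x y" if p: "p \<le> n" and \<sigma>: "\<sigma> \<in> Poly_Mapping.keys (d p)"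
    and xy: "x \<in># simplex_labels lab p \<sigma>" "y \<in># simplex_labels lab p \<sigma>" for p \<sigma> x y
  proof -
    obtain s where "\<sigma> \<in> standard_simplex p \<rightarrow> U s"
      using N[OF p, of \<sigma>] \<sigma> by (auto simp: d_def)
    moreover obtain u v where "u \<in> standard_simplex p" "v \<in> standard_simplex p" "x = lab (\<sigma> u)" "y = lab (\<sigma> v)"
      using vertex[OF xy(1)] vertex[OF xy(2)] by blast
    ultimately show ?thesis using U_nc[of "\<sigma> u" s "\<sigma> v"] by (simp add: Pi_iff)
  qed
  \<comment> \<open>Modulo 2, \<open>T (Suc p)\<close> is the value of the \<open>True\<close>
    cochain on the boundary of \<open>d (Suc p)\<close>, that is, on \<open>d p\<close> and its
    antipode, which together give \<open>T p\<close>. A single vertex is alternating for exactly one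
    starting parity, so \<open>T 0 = 1\<close>.\<close>
  define T where "T p = chain_eval (fan_cochain lab p True) (d p) + chain_eval (fan_cochain lab p False) (d p)" for p
  have "odd (T p)" if "p \<le> n" for p
    using that
  proof (induction p)
    case 0
    obtain \<sigma> where \<sigma>: "c 0 = frag_of \<sigma>" using c0 by blast
    have "d 0 = frag_of \<sigma>"
      using iterated_subdivision_zero[OF c[OF 0]] by (simp add: d_def \<sigma>)
    then show ?case
      by (simp add: T_def fan_cochain_def simplex_labels_def alternating_mset_def)
  next
    case (Suc p)
    have "chain_eval (fan_cochain lab p True) (chain_map p \<nu> (d p)) = chain_eval (fan_cochain lab p False) (d p)"
    proof -
      have p: "p \<le> n" using Suc.prems by simp
      show ?thesis
        using fan_cochain_antipodal[where b = True and lab = lab and \<nu> = \<nu>, OF lab_\<nu> d[OF p] nc[OF p]] by simp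
    qed
    then have "even (chain_eval (fan_cochain lab p True) (chain_boundary (Suc p) (d (Suc p))) - T p)"
      using Suc.prems by (auto simp: bdry_d T_def minus_one_power_iff)
    moreover have "even (chain_eval (fan_cochain lab p True) (chain_boundary (Suc p) (d (Suc p))) + T (Suc p))"
      using fan_cochain_boundary[of lab p True "d (Suc p)"] by (simp add: T_def)
    moreover have "odd (T p)" using Suc by simp
    ultimately show ?case by simp
  qed
  then have "odd (T n)" by simp
  then obtain b where "chain_eval (fan_cochain lab n b) (d n) \<noteq> 0"
    unfolding T_def by (metis add_0 even_zero)
  then obtain \<sigma> where \<sigma>: "\<sigma> \<in> Poly_Mapping.keys (d n)" "fan_cochain lab n b \<sigma> \<noteq> 0"
    by (rule chain_eval_nonzero)
  have "size (simplex_labels lab n \<sigma>) \<le> Suc m"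
  proof (rule alternating_mset_size_le)
    show "alternating_mset b (simplex_labels lab n \<sigma>)" using \<sigma>(2) by (simp add: fan_cochain_def)
    show "\<not> complementary x y" if "x \<in># simplex_labels lab n \<sigma>" "y \<in># simplex_labels lab n \<sigma>" for x y
      using nc \<sigma>(1) that by blast
    show "x div 2 \<le> m" if x: "x \<in># simplex_labels lab n \<sigma>" for x
    proof -
      obtain v where v: "v \<in> standard_simplex n" "x = lab (\<sigma> v)" using vertex[OF x] by blast
      moreover have "\<sigma> v \<in> topspace ?X"
        using N[of n \<sigma>] \<sigma>(1) v(1) by (auto simp: d_def U_def Pi_iff)
      ultimately show ?thesis using big[of "\<sigma> v"] by (simp add: lab_div big_def)
    qed
  qed
  then show ?thesis by (simp add: simplex_labels_def)
qed

section \<open>The index\<close>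

lemma topspace_polyhedron_of:
  "topspace (polyhedron_of K) =
     {x. (\<forall>v. 0 \<le> x v) \<and> {v. x v \<noteq> 0} \<in> K \<and> (\<Sum>v | x v \<noteq> 0. x v) = 1}"
  by (simp add: polyhedron_of_def)

lemma continuous_map_polyhedron_coordinate:
  "continuous_map (polyhedron_of K) euclideanreal (\<lambda>x. x v)"
  unfolding polyhedron_of_def
  by (intro continuous_map_from_subtopology continuous_map_product_projection) auto

lemma continuous_map_into_polyhedron:
  "continuous_map X (polyhedron_of K) f \<longleftrightarrow>
     (\<forall>v. continuous_map X euclideanreal (\<lambda>x. f x v)) \<and> f \<in> topspace X \<rightarrow> topspace (polyhedron_of K)"
  by (auto simp: polyhedron_of_def continuous_map_in_subtopology continuous_map_componentwise_UNIV)

lemma continuous_map_into_nsphere: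
  "continuous_map X (nsphere m) f \<longleftrightarrow>
     (\<forall>i. continuous_map X euclideanreal (\<lambda>x. f x i)) \<and> f \<in> topspace X \<rightarrow> topspace (nsphere m)"
  by (auto simp: nsphere continuous_map_in_subtopology continuous_map_componentwise_UNIV)

lemma minus_1_le_ereal_nat: "-1 \<le> ereal (real m)"
  by (simp add: one_ereal_def)

lemma z2_index_ge_minus_1: "-1 \<le> z2_index X \<nu>"
  by (auto simp: z2_index_def minus_1_le_ereal_nat intro!: INF_greatest)

lemma z2_index_empty: "topspace X = {} \<Longrightarrow> z2_index X \<nu> = -1"
  by (simp add: z2_index_def)

lemma z2_index_leI:
  assumes "continuous_map X (nsphere m) f" "\<And>x. x \<in> topspace X \<Longrightarrow> f (\<nu> x) = - f x"
  shows "z2_index X \<nu> \<le> ereal (real m)"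
proof (cases "topspace X = {}")
  case True
  then show ?thesis using minus_1_le_ereal_nat by (simp only: z2_index_empty)
next
  case False
  then show ?thesis
    unfolding z2_index_def by (auto intro!: INF_lower2[of m] exI[of _ f] assms)
qed

text \<open>A nonempty set of natural numbers attains its infimum, so a finite index comes with a
  map that realises it.\<close>

lemma z2_index_cases:
  obtains (empty) "topspace X = {}" "z2_index X \<nu> = -1"
  | (infinity) "z2_index X \<nu> = \<infinity>"
  | (finite) m f where "topspace X \<noteq> {}" "z2_index X \<nu> = ereal (real m)" "continuous_map X (nsphere m) f"
      "\<And>x. x \<in> topspace X \<Longrightarrow> f (\<nu> x) = - f x"
proof -
  define M where "M = {m. \<exists>f. continuous_map X (nsphere m) f \<and> (\<forall>x\<in>topspace X. f (\<nu> x) = - f x)}"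
  show thesis
  proof (cases "topspace X = {}")
    case True
    then show ?thesis by (intro empty) (auto simp: z2_index_empty)
  next
    case False
    then have ind: "z2_index X \<nu> = (INF m\<in>M. ereal (real m))" by (simp add: z2_index_def M_def)
    show ?thesis
    proof (cases "M = {}")
      case True
      then show ?thesis by (intro infinity) (simp add: ind top_ereal_def)
    next
      case nonempty: False
      define m where "m = (LEAST m. m \<in> M)"
      have "m \<in> M" "\<And>k. k \<in> M \<Longrightarrow> m \<le> k"
        using nonempty unfolding m_def by (metis LeastI all_not_in_conv, simp add: Least_le)
      then have "z2_index X \<nu> = ereal (real m)"
        unfolding ind by (intro antisym INF_lower INF_greatest) auto
      with \<open>m \<in> M\<close> False show ?thesis by (auto simp: M_def intro: finite)
    qed
  qed
qed

lemma z2_index_mono: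
  assumes "continuous_map X Y f" "\<And>x. x \<in> topspace X \<Longrightarrow> f (\<nu> x) = \<mu> (f x)"
  shows "z2_index X \<nu> \<le> z2_index Y \<mu>"
proof (cases Y \<mu> rule: z2_index_cases)
  case empty
  then have "topspace X = {}"
    using assms(1) by (simp add: continuous_map_def Pi_iff) 
  with empty show ?thesis by (simp add: z2_index_empty)
next
  case (finite m g)
  have "f x \<in> topspace Y" if "x \<in> topspace X" for x
    using assms(1) that by (auto simp: continuous_map_def)
  then show ?thesis
    unfolding finite using assms finite
    by (intro z2_index_leI[of _ _ "g \<circ> f"]) (auto intro: continuous_map_compose)
qed auto

text \<open>Dividing by the Euclidean norm gives an odd map to the sphere of dimension
  \<open>card J - 1\<close>. If \<open>J\<close> is empty, so is the space, and the bound -1 is its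
  index by convention.\<close>

lemma z2_index_le_nonvanishing:
  fixes y :: "'j \<Rightarrow> 'x \<Rightarrow> real"
  assumes J: "finite J"
    and cont: "\<And>j. j \<in> J \<Longrightarrow> continuous_map X euclideanreal (y j)"
    and odd: "\<And>j x. j \<in> J \<Longrightarrow> x \<in> topspace X \<Longrightarrow> y j (\<nu> x) = - y j x"
    and nonzero: "\<And>x. x \<in> topspace X \<Longrightarrow> \<exists>j\<in>J. y j x \<noteq> 0"
  shows "z2_index X \<nu> \<le> ereal (real (card J) - 1)"
proof (cases "J = {}")
  case True
  then have "topspace X = {}" using nonzero by blast
  with True show ?thesis by (simp add: z2_index_empty[of X] one_ereal_def del: null_topspace_iff_trivial)
next
  case False
  define m where "m = card J - 1"
  have card: "card J = Suc m" using False J by (simp add: m_def card_gt_0_iff)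
  obtain h where h: "bij_betw h {..m} J"
    using J card by (metis atMost_atLeast0 card_atMost finite_same_card_bij finite_atMost)
  define q where "q x = sqrt (\<Sum>j\<in>J. (y j x)\<^sup>2)" for x
  define f where "f x i = (if i \<le> m then y (h i) x / q x else 0)" for x i
  have hJ: "h i \<in> J" if "i \<le> m" for i using h that by (auto simp: bij_betw_def)
  have q: "q x > 0" if x: "x \<in> topspace X" for x
  proof -
    obtain j where "j \<in> J" "y j x \<noteq> 0" using nonzero[OF x] by blast
    then have "(\<Sum>j\<in>J. (y j x)\<^sup>2) > 0" by (intro sum_pos2[OF J]) auto
    then show ?thesis by (simp add: q_def)
  qed
  have cq: "continuous_map X euclideanreal q"
  proof -
    have "continuous_map X euclideanreal (\<lambda>x. \<Sum>j\<in>J. (y j x)\<^sup>2)"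
      by (intro continuous_map_sum continuous_map_real_pow cont J)
    moreover have "continuous_map euclideanreal euclideanreal sqrt"
      by (simp add: continuous_on_real_sqrt)
    ultimately show ?thesis
      unfolding q_def by (rule continuous_map_compose[unfolded o_def])
  qed
  have "continuous_map X (nsphere m) f"
    unfolding continuous_map_into_nsphere
  proof (intro conjI allI Pi_I)
    fix i
    show "continuous_map X euclideanreal (\<lambda>x. f x i)"
    proof (cases "i \<le> m")
      case True
      then show ?thesis
        unfolding f_def using q cq by (force intro!: continuous_map_real_divide cont hJ)
    qed (simp add: f_def)
  next
    fix x assume x: "x \<in> topspace X"
    have "(\<Sum>i\<le>m. (f x i)\<^sup>2) = (\<Sum>i\<le>m. (y (h i) x / q x)\<^sup>2)" by (simp add: f_def)
    also have "\<dots> = (\<Sum>j\<in>J. (y j x / q x)\<^sup>2)" by (rule sum.reindex_bij_betw[OF h])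
    also have "\<dots> = (\<Sum>j\<in>J. (y j x)\<^sup>2) / (q x)\<^sup>2" by (simp add: power_divide sum_divide_distrib)
    also have "(q x)\<^sup>2 = (\<Sum>j\<in>J. (y j x)\<^sup>2)" by (simp add: q_def sum_nonneg)
    finally have "(\<Sum>i\<le>m. (f x i)\<^sup>2) = 1" using q[OF x] by (auto simp: q_def)
    then show "f x \<in> topspace (nsphere m)" by (simp add: nsphere f_def)
  qed
  moreover have "f (\<nu> x) = - f x" if "x \<in> topspace X" for x
  proof -
    have "q (\<nu> x) = q x" using odd that by (simp add: q_def)
    then show ?thesis using odd[OF hJ that] by (auto simp: f_def fun_eq_iff)
  qed
  ultimately have "z2_index X \<nu> \<le> ereal (real m)" by (rule z2_index_leI)
  then show ?thesis by (simp add: card)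
qed

text \<open>At a zero of \<open>s\<close> continuity holds because \<open>f\<close> is bounded by 1,
  so the product is at most \<open>s\<close> in absolute value.\<close>

lemma continuous_map_vanishing_extension:
  assumes s: "continuous_map X euclideanreal s"
    and f: "continuous_map (subtopology X {x. s x > 0}) euclideanreal f"
    and nonneg: "\<And>x. x \<in> topspace X \<Longrightarrow> 0 \<le> s x"
    and bound: "\<And>x. x \<in> topspace X \<Longrightarrow> s x > 0 \<Longrightarrow> \<bar>f x\<bar> \<le> 1"
  shows "continuous_map X euclideanreal (\<lambda>x. if s x > 0 then s x * f x else 0)"
  unfolding continuous_map_eq_topcontinuous_at
proof
  let ?g = "\<lambda>x. if s x > 0 then s x * f x else 0"
  let ?U = "{x \<in> topspace X. s x > 0}"
  fix a assume a: "a \<in> topspace X"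
  have openU: "openin X ?U"
    using openin_continuous_map_preimage[OF s, of "{0<..}"] by simp
  have sub: "subtopology X {x. s x > 0} = subtopology X ?U"
    by (metis Collect_conj_eq Collect_mem_eq subtopology_restrict)
  show "topcontinuous_at X euclideanreal ?g a"
    unfolding topcontinuous_at_def
  proof (intro conjI allI impI)
    fix V assume V: "openin euclideanreal V \<and> ?g a \<in> V"
    show "\<exists>U. openin X U \<and> a \<in> U \<and> (\<forall>y\<in>U. ?g y \<in> V)"
    proof (cases "s a > 0")
      case True
      have "continuous_map (subtopology X ?U) euclideanreal (\<lambda>x. s x * f x)"
        by (rule continuous_map_real_mult[OF continuous_map_from_subtopology[OF s] f[unfolded sub]])
      then have "openin (subtopology X ?U) {x \<in> topspace (subtopology X ?U). s x * f x \<in> V}"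
        using V by (intro openin_continuous_map_preimage) auto
      then have "openin X {x \<in> topspace (subtopology X ?U). s x * f x \<in> V}"
        using openU openin_open_subtopology by blast
      then show ?thesis
        using True a V by (intro exI[of _ "{x \<in> topspace (subtopology X ?U). s x * f x \<in> V}"]) auto
    next
      case False
      then have "0 \<in> V" using V by simp
      then obtain e where e: "e > 0" "ball 0 e \<subseteq> V" using V open_contains_ball by (metis open_openin)
      have "openin X {x \<in> topspace X. s x \<in> {..<e}}"
        by (rule openin_continuous_map_preimage[OF s]) auto
      moreover have "?g x \<in> V" if "x \<in> topspace X" "s x < e" for x
      proof -
        have "\<bar>?g x\<bar> < e"
        proof (cases "s x > 0")
          case True
          then have "s x * \<bar>f x\<bar> \<le> s x * 1" using bound[OF that(1)] by (intro mult_left_mono) auto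
          then have "s x * \<bar>f x\<bar> < e" using that(2) by linarith
          then show ?thesis using True by (simp add: abs_mult)
        qed (use e in auto)
        then show ?thesis using e(2) by (auto simp: dist_real_def subset_iff)
      qed
      ultimately show ?thesis
        using a False e by (intro exI[of _ "{x \<in> topspace X. s x \<in> {..<e}}"]) auto
    qed
  qed (use a in auto)
qed

text \<open>The joined map has the coordinates \<open>s * f\<close> and \<open>t * g\<close>; they
  have no common zero because \<open>s\<close> or \<open>t\<close> is positive. If one piece is
  empty, its index -1 cancels the 1 and the other piece is all of \<open>X\<close>.\<close>

lemma z2_index_join:
  assumes s: "continuous_map X euclideanreal s" and t: "continuous_map X euclideanreal t"
    and s0: "\<And>x. x \<in> topspace X \<Longrightarrow> 0 \<le> s x" and t0: "\<And>x. x \<in> topspace X \<Longrightarrow> 0 \<le> t x"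
    and s\<nu>: "\<And>x. x \<in> topspace X \<Longrightarrow> s (\<nu> x) = s x" and t\<nu>: "\<And>x. x \<in> topspace X \<Longrightarrow> t (\<nu> x) = t x"
    and cover: "\<And>x. x \<in> topspace X \<Longrightarrow> s x > 0 \<or> t x > 0"
  shows "z2_index X \<nu> \<le> z2_index (subtopology X {x. s x > 0}) \<nu> + z2_index (subtopology X {x. t x > 0}) \<nu> + 1"
    (is "_ \<le> z2_index ?S \<nu> + z2_index ?T \<nu> + 1")
proof (cases ?S \<nu> rule: z2_index_cases)
  case empty
  then have "\<And>x. x \<in> topspace X \<Longrightarrow> t x > 0" using cover by auto
  then have "?T = X" by (metis Collect_mem_eq mem_Collect_eq subsetI subtopology_superset)
  with empty show ?thesis by (cases "z2_index X \<nu>") (auto simp: one_ereal_def)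
next
  case infinity
  then show ?thesis using z2_index_ge_minus_1[of ?T \<nu>] by (cases "z2_index ?T \<nu>") auto
next
  case S: (finite k f)
  show ?thesis
  proof (cases ?T \<nu> rule: z2_index_cases)
    case empty
    then have "\<And>x. x \<in> topspace X \<Longrightarrow> s x > 0" using cover by auto
    then have "?S = X" by (metis Collect_mem_eq mem_Collect_eq subsetI subtopology_superset)
    with empty show ?thesis by (cases "z2_index X \<nu>") (auto simp: one_ereal_def)
  next
    case infinity
    then show ?thesis using S by auto
  next
    case T: (finite l g)
    define y where "y j x = (case j of Inl i \<Rightarrow> if s x > 0 then s x * f x i else 0
       | Inr i \<Rightarrow> if t x > 0 then t x * g x i else 0)" for j x
    have bound: "\<bar>h x i\<bar> \<le> 1" if "continuous_map Y (nsphere r) h" "x \<in> topspace Y" for Y r h x i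
    proof -
      have "(\<Sum>i\<le>r. (h x i)\<^sup>2) = 1" "\<And>i. i > r \<Longrightarrow> h x i = 0"
        using continuous_map_image_subset_topspace[OF that(1)] that(2) by (auto simp: nsphere)
      then have "(h x i)\<^sup>2 \<le> 1"
        using member_le_sum[of i "{..r}" "\<lambda>i. (h x i)\<^sup>2"] by (cases "i \<le> r") auto
      then show ?thesis by (simp add: abs_square_le_1)
    qed
    have coord: "continuous_map Y euclideanreal (\<lambda>x. h x i)" if "continuous_map Y (nsphere r) h" for Y r h i
      using that by (simp add: continuous_map_into_nsphere)
    have nz: "\<exists>i\<le>r. h x i \<noteq> 0" if "continuous_map Y (nsphere r) h" "x \<in> topspace Y" for Y r h x
    proof (rule ccontr)
      assume "\<not> ?thesis"
      then have "(\<Sum>i\<le>r. (h x i)\<^sup>2) = 0" by auto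
      moreover have "(\<Sum>i\<le>r. (h x i)\<^sup>2) = 1"
        using continuous_map_image_subset_topspace[OF that(1)] that(2) by (auto simp: nsphere)
      ultimately show False by simp
    qed
    have "z2_index X \<nu> \<le> ereal (real (card ({..k} <+> {..l})) - 1)"
    proof (rule z2_index_le_nonvanishing)
      fix j assume j: "j \<in> {..k} <+> {..l}"
      show "continuous_map X euclideanreal (y j)"
      proof (cases j)
        case (Inl i)
        have "continuous_map X euclideanreal (\<lambda>x. if s x > 0 then s x * f x i else 0)"
          by (rule continuous_map_vanishing_extension[OF s coord[OF S(3)] s0 bound[OF S(3)]]) auto
        moreover have "y j = (\<lambda>x. if s x > 0 then s x * f x i else 0)" by (simp add: y_def Inl fun_eq_iff)
        ultimately show ?thesis by simp
      next
        case (Inr i)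
        have "continuous_map X euclideanreal (\<lambda>x. if t x > 0 then t x * g x i else 0)"
          by (rule continuous_map_vanishing_extension[OF t coord[OF T(3)] t0 bound[OF T(3)]]) auto
        moreover have "y j = (\<lambda>x. if t x > 0 then t x * g x i else 0)" by (simp add: y_def Inr fun_eq_iff)
        ultimately show ?thesis by simp
      qed
      show "y j (\<nu> x) = - y j x" if "x \<in> topspace X" for x
        using S(4)[of x] T(4)[of x] that by (auto simp: y_def s\<nu> t\<nu> split: sum.split)
    next
      fix x assume x: "x \<in> topspace X"
      show "\<exists>j\<in>{..k} <+> {..l}. y j x \<noteq> 0"
      proof (cases "s x > 0")
        case True
        then obtain i where "i \<le> k" "f x i \<noteq> 0" using nz[OF S(3), of x] x by auto
        then show ?thesis using True by (intro bexI[of _ "Inl i"]) (auto simp: y_def)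
      next
        case False
        then have "t x > 0" using cover[OF x] by simp
        moreover obtain i where "i \<le> l" "g x i \<noteq> 0" using nz[OF T(3), of x] x calculation by auto
        ultimately show ?thesis by (intro bexI[of _ "Inr i"]) (auto simp: y_def)
      qed
    qed auto
    then show ?thesis by (simp add: S T card_Plus add_ac)
  qed
qed

section \<open>Face weights\<close>

text \<open>Moving weights along an involution is the same as reading the coordinates through it.
  Outside the vertices nothing is assumed about \<open>g\<close>, hence the explicit 0.\<close>

lemma affine_extension_involution:
  assumes x: "x \<in> topspace (polyhedron_of K)"
    and g: "\<And>v. v \<in> \<Union>K \<Longrightarrow> g v \<in> \<Union>K" "\<And>v. v \<in> \<Union>K \<Longrightarrow> g (g v) = v"
  shows "affine_extension g x = (\<lambda>v. if v \<in> \<Union>K then x (g v) else 0)"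
proof
  fix w
  have supp: "x v \<noteq> 0 \<Longrightarrow> v \<in> \<Union>K" for v
    using x by (auto simp: topspace_polyhedron_of)
  show "affine_extension g x w = (if w \<in> \<Union>K then x (g w) else 0)"
  proof (cases "w \<in> \<Union>K")
    case True
    have "{v. x v \<noteq> 0 \<and> g v = w} = (if x (g w) \<noteq> 0 then {g w} else {})"
      using True g supp by force
    then show ?thesis using True by (simp add: affine_extension_def split: if_splits)
  next
    case False
    have "g v \<noteq> w" if "x v \<noteq> 0" for v
      using g(1)[OF supp[OF that]] False by auto
    then have "{v. x v \<noteq> 0 \<and> g v = w} = {}" by blast
    then show ?thesis using False by (simp only: affine_extension_def sum.empty if_False)
  qed
qed

text \<open>A vertex \<open>v\<close> of \<open>L\<close> receives the weights of all
  \<open>P\<close> with \<open>v \<in> h P\<close>, and the result is normalised. Nonnegative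
  weights cannot cancel, so the support is exactly the union in \<open>carrier\<close>. Space and
  weights are abstract because both face weights on a polyhedron and coordinates on a sphere are
  inserted.\<close>

lemma z2_index_le_complex_index:
  fixes a :: "'p \<Rightarrow> 'x \<Rightarrow> real" and h :: "'p \<Rightarrow> 'w set"
  assumes I: "finite I"
    and cont: "\<And>P. P \<in> I \<Longrightarrow> continuous_map X euclideanreal (a P)"
    and nonneg: "\<And>P x. P \<in> I \<Longrightarrow> x \<in> topspace X \<Longrightarrow> 0 \<le> a P x"
    and fin: "\<And>P. P \<in> I \<Longrightarrow> finite (h P)"
    and \<gamma>: "\<And>P. P \<in> I \<Longrightarrow> \<gamma> P \<in> I" "\<And>P. P \<in> I \<Longrightarrow> \<gamma> (\<gamma> P) = P"
    and equiv: "\<And>P x. P \<in> I \<Longrightarrow> x \<in> topspace X \<Longrightarrow> a P (\<nu> x) = a (\<gamma> P) x"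
    and h: "\<And>P. P \<in> I \<Longrightarrow> h (\<gamma> P) = g ` h P"
    and g: "\<And>P v. P \<in> I \<Longrightarrow> v \<in> h P \<Longrightarrow> g (g v) = v"
    and carrier: "\<And>x. x \<in> topspace X \<Longrightarrow> (\<Union>P\<in>{P \<in> I. a P x \<noteq> 0}. h P) \<in> L"
    and nonempty: "\<And>x. x \<in> topspace X \<Longrightarrow> \<exists>P\<in>I. a P x \<noteq> 0 \<and> h P \<noteq> {}"
  shows "z2_index X \<nu> \<le> complex_index L g"
proof -
  define W where "W = (\<Union>P\<in>I. h P)"
  have W: "finite W" using I fin by (auto simp: W_def)
  have gW: "g v \<in> W" "g (g v) = v" if v: "v \<in> W" for v
  proof -
    obtain P where P: "P \<in> I" "v \<in> h P" using v by (auto simp: W_def)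
    then have "g v \<in> h (\<gamma> P)" using h by auto
    then show "g v \<in> W" using P \<gamma> by (auto simp: W_def)
    show "g (g v) = v" using g P by auto
  qed
  define w where "w v x = (\<Sum>P\<in>{P \<in> I. v \<in> h P}. a P x)" for v x
  define t where "t x = (\<Sum>v\<in>W. w v x)" for x
  define f where "f x v = (if v \<in> W then w v x / t x else 0)" for x v
  have w0: "w v x \<ge> 0" if "x \<in> topspace X" for v x
    unfolding w_def using nonneg that by (intro sum_nonneg) auto
  have w_pos: "w v x \<noteq> 0 \<longleftrightarrow> (\<exists>P\<in>I. v \<in> h P \<and> a P x \<noteq> 0)" if "x \<in> topspace X" for v x
    unfolding w_def using nonneg that I by (subst sum_nonneg_eq_0_iff) auto
  have t_pos: "t x > 0" if x: "x \<in> topspace X" for x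
  proof -
    obtain P v where P: "P \<in> I" "a P x \<noteq> 0" "v \<in> h P" using nonempty[OF x] by blast
    then have "w v x \<noteq> 0" using w_pos[OF x] by blast
    then have "w v x > 0" using w0[OF x, of v] by simp
    moreover have "v \<in> W" using P by (auto simp: W_def)
    ultimately show ?thesis unfolding t_def using w0[OF x] by (intro sum_pos2[OF W]) auto
  qed
  have cw: "continuous_map X euclideanreal (w v)" for v
    unfolding w_def using I cont by (intro continuous_map_sum) auto
  have ct: "continuous_map X euclideanreal t"
    unfolding t_def using W cw by (intro continuous_map_sum) auto
  have f_top: "f x \<in> topspace (polyhedron_of L)" if x: "x \<in> topspace X" for x
  proof -
    have supp: "{v. f x v \<noteq> 0} \<in> L"
    proof -
      have "{v. f x v \<noteq> 0} = (\<Union>P\<in>{P \<in> I. a P x \<noteq> 0}. h P)"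
        using t_pos[OF x] w_pos[OF x] by (auto simp: f_def W_def)
      then show ?thesis using carrier[OF x] by simp
    qed
    have "(\<Sum>v | f x v \<noteq> 0. f x v) = (\<Sum>v\<in>W. f x v)"
      by (rule sum.mono_neutral_left) (use W in \<open>auto simp: f_def\<close>)
    also have "\<dots> = (\<Sum>v\<in>W. w v x) / t x" by (simp add: f_def sum_divide_distrib)
    also have "\<dots> = 1" using t_pos[OF x] by (simp add: t_def)
    finally have "(\<Sum>v | f x v \<noteq> 0. f x v) = 1" .
    moreover have "0 \<le> f x v" for v
      using w0[OF x, of v] t_pos[OF x] by (simp add: f_def)
    ultimately show ?thesis
      using supp by (simp add: topspace_polyhedron_of)
  qed
  have "continuous_map X (polyhedron_of L) f"
    unfolding continuous_map_into_polyhedron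
  proof (intro conjI allI Pi_I f_top)
    fix v show "continuous_map X euclideanreal (\<lambda>x. f x v)"
    proof (cases "v \<in> W")
      case True
      then show ?thesis
        unfolding f_def using t_pos cw ct by (force intro!: continuous_map_real_divide)
    qed (simp add: f_def)
  qed
  moreover have "f (\<nu> x) = affine_extension g (f x)" if x: "x \<in> topspace X" for x
  proof -
    have w\<nu>: "w v (\<nu> x) = w (g v) x" if v: "v \<in> W" for v
    proof -
      have mem: "g v \<in> h (\<gamma> P) \<longleftrightarrow> v \<in> h P" if "P \<in> I" for P
        using h[OF that] g[OF that] gW[OF v] by (force simp: image_iff)
      then have mem': "v \<in> h (\<gamma> P) \<longleftrightarrow> g v \<in> h P" if "P \<in> I" for P
        using \<gamma>[OF that] that by metis
      have "w v (\<nu> x) = (\<Sum>P\<in>{P \<in> I. v \<in> h P}. a (\<gamma> P) x)"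
        unfolding w_def using x by (intro sum.cong) (auto simp: equiv)
      also have "\<dots> = w (g v) x"
        unfolding w_def
        by (rule sum.reindex_bij_witness[of _ \<gamma> \<gamma>]) (use \<gamma> mem mem' in auto)
      finally show ?thesis .
    qed
    have "t (\<nu> x) = (\<Sum>v\<in>W. w (g v) x)" unfolding t_def by (intro sum.cong) (auto simp: w\<nu>)
    also have "\<dots> = t x"
      unfolding t_def by (rule sum.reindex_bij_witness[of _ g g]) (use gW in auto)
    finally have t\<nu>: "t (\<nu> x) = t x" .
    show ?thesis
    proof
      fix v
      have fW: "f x u \<noteq> 0 \<Longrightarrow> u \<in> W" for u by (auto simp: f_def split: if_splits)
      show "f (\<nu> x) v = affine_extension g (f x) v"
      proof (cases "v \<in> W")
        case True
        have "{u. f x u \<noteq> 0 \<and> g u = v} = (if f x (g v) \<noteq> 0 then {g v} else {})"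
          using True gW fW by force
        then have "affine_extension g (f x) v = f x (g v)"
          by (simp add: affine_extension_def split: if_splits)
        then show ?thesis using True gW by (simp add: f_def w\<nu> t\<nu>)
      next
        case False
        then have "{u. f x u \<noteq> 0 \<and> g u = v} = {}" using gW fW by force
        then show ?thesis using False by (simp only: affine_extension_def sum.empty f_def if_False)
      qed
    qed
  qed
  ultimately show ?thesis
    unfolding complex_index_def by (rule z2_index_mono)
qed

definition face_weight :: "'v set \<Rightarrow> 'v set \<Rightarrow> ('v \<Rightarrow> real) \<Rightarrow> real" where
  "face_weight V A x = (\<Prod>u\<in>A. x u) * (\<Prod>u\<in>A. \<Prod>v\<in>V - A. max 0 (x u - x v))"

lemma face_weight_nonzero_iff:
  assumes "finite V" "A \<subseteq> V"
  shows "face_weight V A x \<noteq> 0 \<longleftrightarrow> (\<forall>u\<in>A. x u \<noteq> 0) \<and> (\<forall>u\<in>A. \<forall>v\<in>V - A. x v < x u)"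
proof -
  have "finite A" using assms finite_subset by blast
  moreover have "max 0 (a - b) = 0 \<longleftrightarrow> \<not> b < a" for a b :: real by (auto simp: max_def)
  ultimately show ?thesis
    using assms by (simp add: face_weight_def prod_zero_iff)
qed

lemma face_weight_chain:
  assumes "finite V" "A \<subseteq> V" "B \<subseteq> V" "face_weight V A x \<noteq> 0" "face_weight V B x \<noteq> 0"
  shows "A \<subseteq> B \<or> B \<subseteq> A"
proof (rule ccontr)
  assume "\<not> ?thesis"
  then obtain u v where "u \<in> A" "u \<notin> B" "v \<in> B" "v \<notin> A" by blast
  moreover from this have "u \<in> V - B" "v \<in> V - A" using assms(2,3) by auto
  ultimately have "x v < x u" "x u < x v"
    using assms face_weight_nonzero_iff[OF assms(1)] by blast+
  then show False by simp
qed

text \<open>\<open>g\<close> is constrained on vertices of \<open>K\<close> only: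
  \<open>CN G\<close> is an involution on closed sets but not on all sets.\<close>

locale z2_complex =
  fixes K :: "'v set set" and g :: "'v \<Rightarrow> 'v"
  assumes finite_vertices: "finite (\<Union>K)"
    and down_closed: "S \<in> K \<Longrightarrow> T \<subseteq> S \<Longrightarrow> T \<in> K"
    and image_simplex: "S \<in> K \<Longrightarrow> g ` S \<in> K"
    and involution: "v \<in> \<Union>K \<Longrightarrow> g (g v) = v"
begin

abbreviation "fw \<equiv> face_weight (\<Union>K)"

lemma finite_complex: "finite K"
  using finite_vertices by (rule finite_UnionD)

lemma g_vertex: "v \<in> \<Union>K \<Longrightarrow> g v \<in> \<Union>K"
  using image_simplex by blast

lemma image_image_simplex: "S \<in> K \<Longrightarrow> g ` g ` S = S"
  using involution by (force simp: image_iff)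

lemma affine_extension_eq:
  "x \<in> topspace (polyhedron_of K) \<Longrightarrow> affine_extension g x = (\<lambda>v. if v \<in> \<Union>K then x (g v) else 0)"
  by (rule affine_extension_involution) (auto intro: involution g_vertex[simplified])

lemma continuous_face_weight:
  assumes "A \<in> K"
  shows "continuous_map (polyhedron_of K) euclideanreal (fw A)"
proof -
  have "finite A" "finite (\<Union>K - A)"
    using assms finite_vertices by (meson Sup_upper finite_subset finite_Diff)+
  then show ?thesis
    unfolding face_weight_def
    by (intro continuous_map_real_mult continuous_map_prod continuous_map_real_max continuous_map_diff
        continuous_map_polyhedron_coordinate) auto
qed

lemma face_weight_nonneg:
  "x \<in> topspace (polyhedron_of K) \<Longrightarrow> 0 \<le> fw A x"
  unfolding face_weight_def by (auto simp: topspace_polyhedron_of intro!: mult_nonneg_nonneg prod_nonneg)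

lemma face_weight_affine_extension:
  assumes x: "x \<in> topspace (polyhedron_of K)" and A: "A \<in> K"
  shows "fw A (affine_extension g x) = fw (g ` A) x"
proof -
  let ?V = "\<Union>K"
  have sub: "A \<subseteq> ?V" using A by blast
  have inj: "inj_on g ?V" by (rule inj_on_inverseI[of _ g]) (rule involution)
  have "g ` ?V = ?V"
  proof (rule equalityI)
    show "g ` ?V \<subseteq> ?V" using g_vertex by (rule image_subsetI)
    show "?V \<subseteq> g ` ?V"
    proof
      fix v assume v: "v \<in> ?V"
      show "v \<in> g ` ?V"
        by (rule image_eqI[of _ _ "g v"]) (simp_all only: involution[OF v] g_vertex[OF v])
    qed
  qed
  then have im: "?V - g ` A = g ` (?V - A)"
    using inj_on_image_set_diff[OF inj, of ?V A] sub by simp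
  have inj': "inj_on g A" "inj_on g (?V - A)"
    using inj sub by (auto intro: inj_on_subset)
  have "(\<Prod>u\<in>g ` A. x u) = (\<Prod>u\<in>A. x (g u))"
    "(\<Prod>u\<in>g ` A. \<Prod>v\<in>g ` (?V - A). max 0 (x u - x v)) = (\<Prod>u\<in>A. \<Prod>v\<in>?V - A. max 0 (x (g u) - x (g v)))"
    by (simp_all only: prod.reindex[OF inj'(1)] prod.reindex[OF inj'(2)] o_def)
  moreover have ext: "affine_extension g x u = x (g u)" if "u \<in> ?V" for u
    using that by (simp only: affine_extension_eq[OF x] if_True)
  have "(\<Prod>u\<in>A. affine_extension g x u) = (\<Prod>u\<in>A. x (g u))"
    by (intro prod.cong refl ext) (use sub in blast)
  moreover have "(\<Prod>u\<in>A. \<Prod>v\<in>?V - A. max 0 (affine_extension g x u - affine_extension g x v)) =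
     (\<Prod>u\<in>A. \<Prod>v\<in>?V - A. max 0 (x (g u) - x (g v)))"
    by (intro prod.cong refl arg_cong2[where f = max] arg_cong2[where f = "(-)"] ext) (use sub in blast)+
  ultimately show ?thesis
    by (simp only: face_weight_def im)
qed

lemma ex_face_weight_nonzero:
  assumes x: "x \<in> topspace (polyhedron_of K)"
  shows "\<exists>A\<in>K - {{}}. fw A x \<noteq> 0"
proof -
  define S where "S = {v. x v \<noteq> 0}"
  have S: "S \<in> K" and sum1: "(\<Sum>v\<in>S. x v) = 1" and x0: "\<And>v. 0 \<le> x v"
    using x by (auto simp: topspace_polyhedron_of S_def)
  have finS: "finite S" using S finite_vertices by (meson Sup_upper finite_subset)
  have neS: "S \<noteq> {}" using sum1 by auto
  \<comment> \<open>The highest superlevel set: its vertices lie in the support and strictly above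
    all others, so its weight is nonzero.\<close>
  define A where "A = {v \<in> S. x v = Max (x ` S)}"
  have "Max (x ` S) \<in> x ` S" using finS neS by (intro Max_in) auto
  then have neA: "A \<noteq> {}" by (auto simp: A_def)
  have AK: "A \<in> K" using S by (rule down_closed) (auto simp: A_def)
  have "x v < x u" if u: "u \<in> A" and v: "v \<notin> A" for u v
  proof (cases "v \<in> S")
    case True
    then have "x v \<le> Max (x ` S)" using finS by simp
    then show ?thesis using u v True by (auto simp: A_def)
  next
    case False
    then have "x v = 0" by (simp add: S_def)
    moreover have "x u \<noteq> 0" using u by (auto simp: A_def S_def)
    ultimately show ?thesis using x0[of u] by simp
  qed
  then have "fw A x \<noteq> 0"
    using AK by (subst face_weight_nonzero_iff[OF finite_vertices]) (auto simp: A_def S_def)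
  then show ?thesis using neA AK by blast
qed

text \<open>At a point of this open set only the faces in \<open>J\<close> are used, and those of
  nonzero weight form a chain inside \<open>J\<close>. Hence \<open>J\<close> can be any invariant
  family of faces, such as the nonfaces in Sarkaria's inequality, and \<open>L\<close> has to
  receive chains inside \<open>J\<close> only.\<close>

lemma z2_index_faces_le:
  fixes h :: "'v set \<Rightarrow> 'w set"
  assumes J: "J \<subseteq> K - {{}}"
    and gJ: "\<And>S. S \<in> J \<Longrightarrow> g ` S \<in> J"
    and fin: "\<And>S. S \<in> J \<Longrightarrow> finite (h S)" and ne: "\<And>S. S \<in> J \<Longrightarrow> h S \<noteq> {}"
    and equiv: "\<And>S. S \<in> J \<Longrightarrow> h (g ` S) = g' ` h S"
    and invol: "\<And>S v. S \<in> J \<Longrightarrow> v \<in> h S \<Longrightarrow> g' (g' v) = v"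
    and carrier: "\<And>C. C \<subseteq> J \<Longrightarrow> C \<noteq> {} \<Longrightarrow> finite C \<Longrightarrow> chain\<^sub>\<subseteq> C \<Longrightarrow> \<Union>(h ` C) \<in> L"
  shows "z2_index (subtopology (polyhedron_of K) {x. \<exists>S\<in>J. fw S x \<noteq> 0}) (affine_extension g)
     \<le> complex_index L g'"
proof -
  have finJ: "finite J" using J finite_complex by (meson finite_Diff finite_subset)
  show ?thesis
  proof (rule z2_index_le_complex_index[where a = fw and h = h and \<gamma> = "(`) g"])
    show "finite J" by (rule finJ)
    fix S assume S: "S \<in> J"
    then have SK: "S \<in> K" using J by auto
    show "continuous_map (subtopology (polyhedron_of K) {x. \<exists>S\<in>J. fw S x \<noteq> 0}) euclideanreal (fw S)"
      using continuous_face_weight[OF SK] by (rule continuous_map_from_subtopology)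
    show "g ` g ` S = S" using image_image_simplex[OF SK] .
    show "fw S (affine_extension g x) = fw (g ` S) x"
      if "x \<in> topspace (subtopology (polyhedron_of K) {x. \<exists>S\<in>J. fw S x \<noteq> 0})" for x
      using that SK by (intro face_weight_affine_extension) auto
  next
    fix x assume x: "x \<in> topspace (subtopology (polyhedron_of K) {x. \<exists>S\<in>J. fw S x \<noteq> 0})"
    then obtain S where "S \<in> J" "fw S x \<noteq> 0" by auto
    moreover have "chain\<^sub>\<subseteq> {S \<in> J. fw S x \<noteq> 0}"
      unfolding chain_subset_def using face_weight_chain[OF finite_vertices] J by blast
    ultimately show "\<Union>(h ` {S \<in> J. fw S x \<noteq> 0}) \<in> L"
      using finJ by (intro carrier) auto
    show "\<exists>S\<in>J. fw S x \<noteq> 0 \<and> h S \<noteq> {}"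
      using \<open>S \<in> J\<close> \<open>fw S x \<noteq> 0\<close> ne by blast
  qed (use fin gJ equiv invol face_weight_nonneg in auto)
qed

lemma complex_index_le:
  fixes h :: "'v set \<Rightarrow> 'w set"
  assumes "\<And>S. S \<in> K - {{}} \<Longrightarrow> finite (h S)" "\<And>S. S \<in> K - {{}} \<Longrightarrow> h S \<noteq> {}"
    and "\<And>S. S \<in> K - {{}} \<Longrightarrow> h (g ` S) = g' ` h S"
    and "\<And>S v. S \<in> K - {{}} \<Longrightarrow> v \<in> h S \<Longrightarrow> g' (g' v) = v"
    and "\<And>C. C \<subseteq> K - {{}} \<Longrightarrow> C \<noteq> {} \<Longrightarrow> finite C \<Longrightarrow> chain\<^sub>\<subseteq> C \<Longrightarrow> \<Union>(h ` C) \<in> L"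
  shows "complex_index K g \<le> complex_index L g'"
proof -
  have "subtopology (polyhedron_of K) {x. \<exists>S\<in>K - {{}}. fw S x \<noteq> 0} = polyhedron_of K"
    using ex_face_weight_nonzero by (intro subtopology_superset) auto
  then show ?thesis
    using z2_index_faces_le[of "K - {{}}" h g' L] assms image_simplex by (simp add: complex_index_def)
qed

text \<open>The total weights of \<open>J\<close> and of the other nonempty faces serve as
  \<open>s\<close> and \<open>t\<close> in \<open>z2_index_join\<close>; every point has a nonempty
  face of nonzero weight, and it belongs to one of the two families.\<close>

lemma complex_index_le_join:
  assumes J: "J \<subseteq> K - {{}}" and gJ: "\<And>S. S \<in> J \<Longrightarrow> g ` S \<in> J"
  shows "complex_index K g \<le>
     z2_index (subtopology (polyhedron_of K) {x. \<exists>S\<in>J. fw S x \<noteq> 0}) (affine_extension g) +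
     z2_index (subtopology (polyhedron_of K) {x. \<exists>S\<in>K - {{}} - J. fw S x \<noteq> 0}) (affine_extension g) + 1"
proof -
  let ?X = "polyhedron_of K"
  define s where "s I x = (\<Sum>S\<in>I. fw S x)" for I x
  have pos: "s I x > 0 \<longleftrightarrow> (\<exists>S\<in>I. fw S x \<noteq> 0)" if "x \<in> topspace ?X" "I \<subseteq> K" for x I
  proof -
    have "finite I" using that finite_complex finite_subset by blast
    then have "s I x = 0 \<longleftrightarrow> (\<forall>S\<in>I. fw S x = 0)"
      unfolding s_def using face_weight_nonneg[OF that(1)] by (intro sum_nonneg_eq_0_iff) auto
    moreover have "s I x \<ge> 0" unfolding s_def using face_weight_nonneg[OF that(1)] by (intro sum_nonneg)
    ultimately show ?thesis by auto
  qed
  have sub: "subtopology ?X {x. s I x > 0} = subtopology ?X {x. \<exists>S\<in>I. fw S x \<noteq> 0}" if "I \<subseteq> K" for I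
  proof -
    have "topspace ?X \<inter> {x. s I x > 0} = topspace ?X \<inter> {x. \<exists>S\<in>I. fw S x \<noteq> 0}"
      using pos that by auto
    then show ?thesis by (subst (1 2) subtopology_restrict[symmetric]) (simp only:)
  qed
  have cont: "continuous_map ?X euclideanreal (s I)" if "I \<subseteq> K" for I
    unfolding s_def using that finite_subset[OF that finite_complex] continuous_face_weight
    by (intro continuous_map_sum) auto
  have inv: "s I (affine_extension g x) = s I x"
    if "I \<subseteq> K" "\<And>S. S \<in> I \<Longrightarrow> g ` S \<in> I" "x \<in> topspace ?X" for I x
  proof -
    have "s I (affine_extension g x) = (\<Sum>S\<in>I. fw (g ` S) x)"
      unfolding s_def using that by (intro sum.cong face_weight_affine_extension) auto
    also have "\<dots> = s I x"
      unfolding s_def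
      by (rule sum.reindex_bij_witness[of _ "(`) g" "(`) g"])
        (use that in \<open>simp_all add: image_image_simplex subset_iff\<close>)
    finally show ?thesis .
  qed
  let ?J' = "K - {{}} - J"
  have gJ': "g ` S \<in> ?J'" if "S \<in> ?J'" for S
  proof -
    have "g ` S \<notin> J" using gJ[of "g ` S"] image_image_simplex that by auto
    then show ?thesis using that image_simplex by auto
  qed
  have JK: "J \<subseteq> K" "?J' \<subseteq> K" using J by auto
  have "z2_index ?X (affine_extension g) \<le> z2_index (subtopology ?X {x. s J x > 0}) (affine_extension g)
      + z2_index (subtopology ?X {x. s ?J' x > 0}) (affine_extension g) + 1"
  proof (rule z2_index_join)
    show "s J x > 0 \<or> s ?J' x > 0" if "x \<in> topspace ?X" for x
      using ex_face_weight_nonzero[OF that] pos[OF that JK(1)] pos[OF that JK(2)] by auto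
    show "s J (affine_extension g x) = s J x" if "x \<in> topspace ?X" for x
      using inv[OF JK(1)] gJ that by blast
    show "s ?J' (affine_extension g x) = s ?J' x" if "x \<in> topspace ?X" for x
      using inv[OF JK(2)] gJ' that by blast
    show "0 \<le> s J x" "0 \<le> s ?J' x" if "x \<in> topspace ?X" for x
      using that by (auto simp: s_def intro!: sum_nonneg face_weight_nonneg)
  qed (rule cont[OF JK(1)], rule cont[OF JK(2)])
  then show ?thesis using JK by (simp add: sub complex_index_def)
qed

end

section \<open>Box complexes and deleted joins\<close>

lemma swap_sides_simps [simp]: "swap_sides (Inl v) = Inr v" "swap_sides (Inr v) = Inl v"
  by (simp_all add: swap_sides_def)

lemma swap_sides_swap_sides [simp]: "swap_sides (swap_sides v) = v"
  by (cases v) auto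

lemma mem_image_swap_sides: "v \<in> swap_sides ` S \<longleftrightarrow> swap_sides v \<in> S"
  by (metis imageE imageI swap_sides_swap_sides)

lemma vimage_swap_sides [simp]:
  "Inl -` swap_sides ` S = Inr -` S" "Inr -` swap_sides ` S = Inl -` S"
  by (simp_all add: set_eq_iff mem_image_swap_sides)

lemma vimage_Plus [simp]: "Inl -` (A <+> B) = A" "Inr -` (A <+> B) = B"
  by auto

lemma Plus_vimage: "Inl -` S <+> Inr -` S = S"
proof -
  have "v \<in> Inl -` S <+> Inr -` S \<longleftrightarrow> v \<in> S" for v by (cases v) auto
  then show ?thesis by blast
qed

lemma swap_sides_Plus [simp]: "swap_sides ` (A <+> B) = B <+> A"
  by (metis Plus_vimage vimage_Plus vimage_swap_sides)

text \<open>A sum \<open>A <+> B\<close> determines both sides, so membership in such a complex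
  becomes a condition on two preimages.\<close>

lemma Plus_Collect_iff: "S \<in> {A <+> B | A B. P A B} \<longleftrightarrow> P (Inl -` S) (Inr -` S)"
proof
  assume "P (Inl -` S) (Inr -` S)"
  then show "S \<in> {A <+> B | A B. P A B}" by (metis (mono_tags, lifting) Plus_vimage mem_Collect_eq)
qed auto

lemma Plus_eq_empty_iff: "S = {} \<longleftrightarrow> Inl -` S = {} \<and> Inr -` S = {}"
proof -
  have "S = {} \<longleftrightarrow> Inl -` S <+> Inr -` S = {}" by (simp only: Plus_vimage)
  then show ?thesis by (simp only: Plus_eq_empty_conv)
qed

lemma z2_complex_Plus:
  assumes V: "finite V" and sub: "\<And>A B. P A B \<Longrightarrow> A \<subseteq> V \<and> B \<subseteq> V"
    and down: "\<And>A B A' B'. P A B \<Longrightarrow> A' \<subseteq> A \<Longrightarrow> B' \<subseteq> B \<Longrightarrow> P A' B'"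
    and sym: "\<And>A B. P A B \<Longrightarrow> P B A"
  shows "z2_complex {A <+> B | A B. P A B} swap_sides"
proof
  have "\<Union>{A <+> B | A B. P A B} \<subseteq> V <+> V" using sub by blast
  then show "finite (\<Union>{A <+> B | A B. P A B})" by (rule finite_subset) (use V in simp)
  show "T \<in> {A <+> B | A B. P A B}" if "S \<in> {A <+> B | A B. P A B}" "T \<subseteq> S" for S T
    using that down unfolding Plus_Collect_iff by (meson vimage_mono)
  show "swap_sides ` S \<in> {A <+> B | A B. P A B}" if "S \<in> {A <+> B | A B. P A B}" for S
    using that sym unfolding Plus_Collect_iff by simp
qed auto

lemma z2_complex_deleted_join:
  assumes "finite V" "\<And>S. S \<in> L \<Longrightarrow> S \<subseteq> V" "\<And>S T. S \<in> L \<Longrightarrow> T \<subseteq> S \<Longrightarrow> T \<in> L"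
  shows "z2_complex (deleted_join L) swap_sides"
  unfolding deleted_join_def by (rule z2_complex_Plus[of V]) (use assms in blast)+

lemma deleted_join_iff:
  "S \<in> deleted_join L \<longleftrightarrow> Inl -` S \<in> L \<and> Inr -` S \<in> L \<and> Inl -` S \<inter> Inr -` S = {}"
  unfolding deleted_join_def Plus_Collect_iff ..

text \<open>The last assumption admits order-preserving and order-reversing \<open>g\<close>:
  swapping sides preserves inclusion, \<open>CN G\<close> reverses it.\<close>

lemma z2_complex_order_complex:
  assumes "finite \<S>" "\<And>A. A \<in> \<S> - {{}} \<Longrightarrow> g A \<in> \<S> - {{}}" "\<And>A. A \<in> \<S> - {{}} \<Longrightarrow> g (g A) = A"
    and "\<And>A B. A \<in> \<S> - {{}} \<Longrightarrow> B \<in> \<S> - {{}} \<Longrightarrow> A \<subseteq> B \<Longrightarrow> g A \<subseteq> g B \<or> g B \<subseteq> g A"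
  shows "z2_complex (order_complex \<S>) g"
proof
  have "\<Union>(order_complex \<S>) \<subseteq> \<S>" by (auto simp: order_complex_def)
  then show "finite (\<Union>(order_complex \<S>))" by (rule finite_subset) (rule assms(1))
  show "T \<in> order_complex \<S>" if "S \<in> order_complex \<S>" "T \<subseteq> S" for S T
  proof -
    have "finite T" using that finite_subset[OF that(2)] by (simp add: order_complex_def)
    moreover have "T \<subseteq> \<S> - {{}}" "chain\<^sub>\<subseteq> T"
      using that unfolding order_complex_def chain_subset_def mem_Collect_eq by (meson order_trans subsetD)+
    ultimately show ?thesis by (simp add: order_complex_def)
  qed
  show "g ` S \<in> order_complex \<S>" if "S \<in> order_complex \<S>" for S
  proof -
    have S: "finite S" "S \<subseteq> \<S> - {{}}" "chain\<^sub>\<subseteq> S"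
      using that by (auto simp: order_complex_def)
    then have "g ` S \<subseteq> \<S> - {{}}" using assms(2) by blast
    moreover have "chain\<^sub>\<subseteq> (g ` S)"
      unfolding chain_subset_def
    proof (intro ballI)
      fix x y assume "x \<in> g ` S" "y \<in> g ` S"
      then obtain A B where "A \<in> S" "B \<in> S" "x = g A" "y = g B" by blast
      moreover from this have "A \<subseteq> B \<or> B \<subseteq> A" using S(3) by (simp add: chain_subset_def)
      ultimately show "x \<subseteq> y \<or> y \<subseteq> x" using assms(4)[of A B] assms(4)[of B A] S(2) by blast
    qed
    ultimately show ?thesis using S(1) by (simp add: order_complex_def)
  qed
  show "g (g A) = A" if "A \<in> \<Union>(order_complex \<S>)" for A
    using that assms(3) by (auto simp: order_complex_def)
qed

lemma finite_chain_extrema: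
  assumes "finite C" "C \<noteq> {}" "chain\<^sub>\<subseteq> C"
  shows "\<Union>C \<in> C" "\<Inter>C \<in> C"
proof -
  have "\<Union>C \<in> C \<and> \<Inter>C \<in> C"
    using assms
  proof (induction C rule: finite_ne_induct)
    case (insert S C)
    then have "\<Union>C \<in> C" "\<Inter>C \<in> C" by (auto simp: chain_subset_def)
    moreover from this have "S \<subseteq> \<Union>C \<or> \<Union>C \<subseteq> S" "S \<subseteq> \<Inter>C \<or> \<Inter>C \<subseteq> S"
      using insert.prems unfolding chain_subset_def by (meson insertCI)+
    ultimately show ?case
      by (auto simp: Un_absorb1 Un_absorb2 Int_absorb1 Int_absorb2 simp del: Union_iff Inter_iff)
  qed auto
  then show "\<Union>C \<in> C" "\<Inter>C \<in> C" by auto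
qed

section \<open>Common neighbours, box complexes and closed sets of a graph\<close>

locale finite_loopless_graph =
  fixes G :: "'a graph"
  assumes finite_verts: "finite (verts G)" and loopless: "{v} \<notin> edges G"
begin

abbreviation "cn \<equiv> CN G"

lemma cn_subset: "cn A \<subseteq> verts G" and cn_antimono: "A \<subseteq> B \<Longrightarrow> cn B \<subseteq> cn A"
  and cn_empty [simp]: "cn {} = verts G"
  by (auto simp: CN_def)

lemma subset_cn_cn: "A \<subseteq> verts G \<Longrightarrow> A \<subseteq> cn (cn A)"
  by (auto simp: CN_def insert_commute)

lemma cn_cn_cn: "A \<subseteq> verts G \<Longrightarrow> cn (cn (cn A)) = cn A"
  using subset_cn_cn cn_subset cn_antimono by (metis antisym)

lemma disjoint_cn: "A \<inter> cn A = {}"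
  using loopless by (auto simp: CN_def)

lemma cn_eq_verts: "cn A = verts G \<Longrightarrow> A \<subseteq> verts G \<Longrightarrow> A = {}"
  using disjoint_cn[of A] by blast

lemma complete_between_iff: "B \<subseteq> verts G \<Longrightarrow> complete_between G A B \<longleftrightarrow> B \<subseteq> cn A"
  by (auto simp: complete_between_def CN_def)

lemma complete_between_sym: "complete_between G A B \<Longrightarrow> complete_between G B A"
  unfolding complete_between_def by (metis insert_commute)

sublocale box: z2_complex "box_complex G" swap_sides
proof -
  have eq: "box_complex G = {A <+> B | A B. A \<subseteq> verts G \<and> B \<subseteq> verts G \<and> A \<inter> B = {} \<and>
     complete_between G A B \<and> cn A \<noteq> {} \<and> cn B \<noteq> {}}"
    by (rule box_complex_def)
  show "z2_complex (box_complex G) swap_sides"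
    unfolding eq
  proof (rule z2_complex_Plus[OF finite_verts], goal_cases)
    case (2 A B A' B')
    then have "cn A \<subseteq> cn A'" "cn B \<subseteq> cn B'"
      by (simp_all add: cn_antimono)
    moreover have "complete_between G A' B'"
      using 2 unfolding complete_between_def by blast
    ultimately show ?case using 2 by blast
  next
    case (3 A B)
    then show ?case using complete_between_sym by blast
  qed blast
qed

sublocale box0: z2_complex "box_complex0 G" swap_sides
proof -
  have eq: "box_complex0 G = {A <+> B | A B. A \<subseteq> verts G \<and> B \<subseteq> verts G \<and> A \<inter> B = {} \<and>
     complete_between G A B}"
    by (rule box_complex0_def)
  show "z2_complex (box_complex0 G) swap_sides"
    unfolding eq
  proof (rule z2_complex_Plus[OF finite_verts], goal_cases)
    case (2 A B A' B')
    then have "complete_between G A' B'"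
      unfolding complete_between_def by blast
    then show ?case using 2 by blast
  next
    case (3 A B)
    then show ?case using complete_between_sym by blast
  qed blast
qed

lemma box_complex_iff:
  "S \<in> box_complex G \<longleftrightarrow> Inl -` S \<subseteq> verts G \<and> Inr -` S \<subseteq> verts G \<and> Inr -` S \<subseteq> cn (Inl -` S) \<and>
     cn (Inl -` S) \<noteq> {} \<and> cn (Inr -` S) \<noteq> {}"
  unfolding box_complex_def Plus_Collect_iff 
  using disjoint_cn[of "Inl -` S"] complete_between_iff[of "Inr -` S" "Inl -` S"] by blast

lemma box_complex0_iff:
  "S \<in> box_complex0 G \<longleftrightarrow> Inl -` S \<subseteq> verts G \<and> Inr -` S \<subseteq> verts G \<and> Inr -` S \<subseteq> cn (Inl -` S)"
  unfolding box_complex0_def Plus_Collect_iff 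
  using disjoint_cn[of "Inl -` S"] complete_between_iff[of "Inr -` S" "Inl -` S"] by blast

definition closed_sets :: "'a set set" where
  "closed_sets = {A. A \<noteq> {} \<and> A \<subset> verts G \<and> cn (cn A) = A}"

lemma lovasz_complex_eq: "lovasz_complex G = order_complex closed_sets"
  by (simp add: lovasz_complex_def closed_sets_def)

lemma finite_closed_sets: "finite closed_sets"
  by (rule finite_subset[of _ "Pow (verts G)"]) (auto simp: closed_sets_def finite_verts)

lemma empty_not_closed: "closed_sets - {{}} = closed_sets"
  by (auto simp: closed_sets_def)

lemma cn_closed_set:
  assumes "A \<in> closed_sets"
  shows "cn A \<in> closed_sets"
proof -
  have A: "A \<noteq> {}" "A \<subset> verts G" "cn (cn A) = A" using assms by (auto simp: closed_sets_def)
  then have "cn A \<noteq> {}" "cn A \<noteq> verts G" using cn_eq_verts by auto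
  with A cn_subset show ?thesis by (auto simp: closed_sets_def)
qed

sublocale lovasz: z2_complex "lovasz_complex G" cn
  unfolding lovasz_complex_eq
  by (rule z2_complex_order_complex[OF finite_closed_sets])
    (auto simp: empty_not_closed cn_closed_set closed_sets_def[symmetric] cn_antimono, auto simp: closed_sets_def)

text \<open>A face \<open>A \<uplus> B\<close> determines the interval \<open>CN (CN A) \<subseteq> CN B\<close> of closed sets. It shrinks when
  the face grows, and its end points are exchanged by the involutions; hence the end points of the
  intervals of a chain of faces form a chain.\<close>

lemma complex_index_box_le_lovasz: "complex_index (box_complex G) swap_sides \<le> complex_index (lovasz_complex G) cn"
proof -
  \<comment> \<open>An empty side contributes no end point: the formula would give \<open>{}\<close>
    or \<open>verts G\<close>, which are no vertices of the Lovasz complex.\<close>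
  define h where "h S = (if Inl -` S = {} then {} else {cn (cn (Inl -` S))}) \<union>
     (if Inr -` S = {} then {} else {cn (Inr -` S)})" for S :: "('a + 'a) set"
  show ?thesis
  proof (rule box.complex_index_le[where h = h])
    fix S assume S: "S \<in> box_complex G - {{}}"
    then have sub: "Inl -` S \<subseteq> verts G" "Inr -` S \<subseteq> verts G" by (auto simp: box_complex_iff)
    show "finite (h S)" by (simp add: h_def)
    show "h S \<noteq> {}" using S by (auto simp: h_def Plus_eq_empty_iff[of S])
    show "h (swap_sides ` S) = cn ` h S"
      using sub by (auto simp: h_def cn_cn_cn)
    show "cn (cn A) = A" if "A \<in> h S" for A
      using that sub by (auto simp: h_def cn_cn_cn cn_subset split: if_splits)
  next
    fix C assume C: "C \<subseteq> box_complex G - {{}}" "finite C" "chain\<^sub>\<subseteq> C"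
    have "h S \<subseteq> closed_sets" if "S \<in> C" for S
    proof -
      have S: "S \<in> box_complex G" using that C by blast
      then have "cn (cn (Inl -` S)) \<in> closed_sets" if "Inl -` S \<noteq> {}"
        using that subset_cn_cn[of "Inl -` S"] cn_subset[of "cn (Inl -` S)"] cn_eq_verts[of "cn (Inl -` S)"]
          cn_subset[of "Inl -` S"] cn_cn_cn[of "Inl -` S"]
        unfolding closed_sets_def box_complex_iff by auto
      moreover have "cn (Inr -` S) \<in> closed_sets" if "Inr -` S \<noteq> {}"
        using that S cn_subset[of "Inr -` S"] cn_eq_verts[of "Inr -` S"] cn_cn_cn[of "Inr -` S"]
        unfolding closed_sets_def box_complex_iff by auto
      ultimately show ?thesis by (auto simp: h_def)
    qed
    moreover have "finite (\<Union>(h ` C))" using C by (auto simp: h_def)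
    moreover have "X \<subseteq> Y \<or> Y \<subseteq> X" if "S \<in> C" "T \<in> C" "X \<in> h S" "Y \<in> h T" for S T X Y
    proof -
      have ST: "S \<subseteq> T \<or> T \<subseteq> S" using C that by (auto simp: chain_subset_def)
      then have cmp: "Inl -` S \<subseteq> Inl -` T \<and> Inr -` S \<subseteq> Inr -` T \<or> Inl -` T \<subseteq> Inl -` S \<and> Inr -` T \<subseteq> Inr -` S"
        by (meson vimage_mono)
      have face: "Inr -` S \<subseteq> cn (Inl -` S)" "Inr -` T \<subseteq> cn (Inl -` T)"
        using C(1) that(1,2) box_complex_iff by blast+
      \<comment> \<open>The mixed inclusions hold whichever face is larger: the sides of the larger
        face are completely joined and contain those of the smaller one.\<close>
      have "Inr -` T \<subseteq> cn (Inl -` S)" "Inr -` S \<subseteq> cn (Inl -` T)"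
        using cmp face cn_antimono by (meson order_trans)+
      then have "cn (cn (Inl -` S)) \<subseteq> cn (Inr -` T)" "cn (cn (Inl -` T)) \<subseteq> cn (Inr -` S)"
        by (simp_all add: cn_antimono)
      moreover have "cn (cn (Inl -` S)) \<subseteq> cn (cn (Inl -` T)) \<or> cn (cn (Inl -` T)) \<subseteq> cn (cn (Inl -` S))"
        "cn (Inr -` S) \<subseteq> cn (Inr -` T) \<or> cn (Inr -` T) \<subseteq> cn (Inr -` S)"
        using cmp by (meson cn_antimono)+
      ultimately show ?thesis
        using that(3,4) by (auto simp: h_def split: if_splits)
    qed
    then have "chain\<^sub>\<subseteq> (\<Union>(h ` C))" by (auto simp: chain_subset_def)
    ultimately show "\<Union>(h ` C) \<in> lovasz_complex G"
      by (auto simp: lovasz_complex_eq order_complex_def empty_not_closed)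
  qed
qed

text \<open>If \<open>A\<close> is the least and \<open>B\<close> the greatest member of a chain,
  then \<open>cn B \<subseteq> cn A\<close>, so \<open>A\<close> and \<open>cn B\<close> are
  completely joined. The involution reverses the chain: its least member becomes
  \<open>cn B\<close>, and the common neighbours of its greatest member become
  \<open>A\<close>.\<close>

lemma complex_index_lovasz_le_box: "complex_index (lovasz_complex G) cn \<le> complex_index (box_complex G) swap_sides"
proof -
  define h where "h C = \<Inter>C <+> cn (\<Union>C)" for C
  have C: "finite C" "C \<noteq> {}" "chain\<^sub>\<subseteq> C" "C \<subseteq> closed_sets" "\<Union>C \<in> C" "\<Inter>C \<in> C"
    if "C \<in> lovasz_complex G - {{}}" for C
    using that finite_chain_extrema[of C] by (auto simp: lovasz_complex_eq order_complex_def)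
  show ?thesis
  proof (rule lovasz.complex_index_le[where h = h])
    fix C assume "C \<in> lovasz_complex G - {{}}"
    note C = C[OF this]
    have M: "\<Union>C \<in> closed_sets" "\<Inter>C \<in> closed_sets" using C by auto
    then have "\<Inter>C \<subseteq> verts G" and ne: "\<Inter>C \<noteq> {}" by (auto simp: closed_sets_def)
    then have fin: "finite (\<Inter>C)" "finite (cn (\<Union>C))"
      using finite_subset[OF _ finite_verts] cn_subset by auto
    then show "finite (h C)" "h C \<noteq> {}" using ne by (simp_all add: h_def Plus_eq_empty_conv)
    have "\<Inter>(cn ` C) = cn (\<Union>C)"
      using C(2) unfolding CN_def by blast
    moreover have "cn (\<Union>(cn ` C)) = \<Inter>C"
    proof -
      have "\<Union>(cn ` C) = cn (\<Inter>C)"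
        using C(6) by (auto dest: cn_antimono[OF Inter_lower])
      then show ?thesis using M(2) by (simp add: closed_sets_def)
    qed
    ultimately show "h (cn ` C) = swap_sides ` h C" by (simp add: h_def)
    show "swap_sides (swap_sides v) = v" for v :: "'a + 'a" by simp
  next
    fix \<D> assume \<D>: "\<D> \<subseteq> lovasz_complex G - {{}}" "\<D> \<noteq> {}" "finite \<D>" "chain\<^sub>\<subseteq> \<D>"
    \<comment> \<open>Enlarging a chain can only lower its least member and raise its greatest one,
      so \<open>h\<close> reverses inclusion and the smallest chain of \<open>\<D>\<close> gives the
      whole union.\<close>
    define C where "C = \<Inter>\<D>"
    have CD: "C \<in> \<D>" using finite_chain_extrema \<D> by (auto simp: C_def)
    have "h D \<subseteq> h C" if "D \<in> \<D>" for D
    proof -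
      have "C \<subseteq> D" using that by (auto simp: C_def)
      then have "\<Inter>D \<subseteq> \<Inter>C" "\<Union>C \<subseteq> \<Union>D" by blast+
      then show ?thesis unfolding h_def using cn_antimono[of "\<Union>C" "\<Union>D"] by blast
    qed
    then have eq: "\<Union>(h ` \<D>) = h C" using CD by blast
    have "C \<in> lovasz_complex G - {{}}" using CD \<D> by blast
    note C = C[OF this]
    have M: "\<Union>C \<in> closed_sets" "\<Inter>C \<in> closed_sets" using C by auto
    then have "cn (\<Inter>C) \<noteq> {}" "cn (cn (\<Union>C)) \<noteq> {}" "\<Inter>C \<subseteq> verts G"
      using cn_closed_set[OF M(1)] cn_closed_set[OF M(2)] by (simp_all add: closed_sets_def less_imp_le)
    moreover have "cn (\<Union>C) \<subseteq> cn (\<Inter>C)" using C(2) by (intro cn_antimono) blast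
    ultimately show "\<Union>(h ` \<D>) \<in> box_complex G"
      unfolding eq box_complex_iff h_def by (simp add: cn_subset)
  qed
qed

lemma complex_index_box_eq_lovasz: "complex_index (box_complex G) swap_sides = complex_index (lovasz_complex G) cn"
  by (rule antisym complex_index_box_le_lovasz complex_index_lovasz_le_box)+

lemma box_subset_box0: "box_complex G \<subseteq> box_complex0 G"
  unfolding box_complex_def box_complex0_def by blast

text \<open>A nonempty face of \<open>box_complex0 G\<close> outside \<open>box_complex G\<close> lives on one side only, and comparable
  ones live on the same side; so these faces contribute a suspension coordinate.\<close>

lemma complex_index_box0_le: "complex_index (box_complex0 G) swap_sides \<le> complex_index (box_complex G) swap_sides + 1"
proof -
  let ?X = "polyhedron_of (box_complex0 G)" and ?\<nu> = "affine_extension swap_sides :: ('a + 'a \<Rightarrow> real) \<Rightarrow> _"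
  let ?J = "box_complex G - {{}}"
  let ?J' = "box_complex0 G - {{}} - ?J"
  have swap: "swap_sides ` S \<in> ?J" if "S \<in> ?J" for S using that box.image_simplex by auto
  have J: "?J \<subseteq> box_complex0 G - {{}}" using box_subset_box0 by auto
  have A: "z2_index (subtopology ?X {x. \<exists>S\<in>?J. box0.fw S x \<noteq> 0}) ?\<nu> \<le> complex_index (box_complex G) swap_sides"
  \<comment> \<open>With \<open>h\<close> the identity, the union over a chain of faces is its
    greatest face.\<close>
  proof (rule box0.z2_index_faces_le[where h = "\<lambda>S. S", OF J swap])
    show "finite S" if "S \<in> ?J" for S
      using that box.finite_vertices finite_subset by (metis DiffD1 Sup_upper)
    show "\<Union>((\<lambda>S. S) ` C) \<in> box_complex G" if "C \<subseteq> ?J" "C \<noteq> {}" "finite C" "chain\<^sub>\<subseteq> C" for C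
      using finite_chain_extrema(1)[of C] that by auto
  qed auto
  have B: "z2_index (subtopology ?X {x. \<exists>S\<in>?J'. box0.fw S x \<noteq> 0}) ?\<nu> \<le> ereal (real (card {()}) - 1)"
  proof (rule z2_index_le_nonvanishing)
    define sgn :: "('a + 'a) set \<Rightarrow> real" where "sgn S = (if Inl -` S = {} then - 1 else 1)" for S
    define y where "y x = (\<Sum>S\<in>?J'. sgn S * box0.fw S x)" for x
    let ?Y = "subtopology ?X {x. \<exists>S\<in>?J'. box0.fw S x \<noteq> 0}"
    have finJ': "finite ?J'" using box0.finite_complex by auto
    have side: "Inl -` S = {} \<longleftrightarrow> Inr -` S \<noteq> {}" if "S \<in> ?J'" for S
    proof -
      have "Inl -` S = {} \<or> Inr -` S = {}"
      proof (rule ccontr)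
        \<comment> \<open>If both sides are nonempty, each lies in the common neighbours of the
          other, so both sets of common neighbours are nonempty.\<close>
        assume ne: "\<not> ?thesis"
        have "Inr -` S \<subseteq> cn (Inl -` S)" "Inl -` S \<subseteq> verts G"
          using that by (auto simp: box_complex0_iff)
        moreover from this have "Inl -` S \<subseteq> cn (Inr -` S)" 
          using subset_cn_cn cn_antimono by blast
        moreover have "Inr -` S \<subseteq> verts G" using that by (auto simp: box_complex0_iff)
        ultimately have "S \<in> box_complex G"
          using ne unfolding box_complex_iff by auto
        then show False using that by simp
      qed
      moreover have "S \<noteq> {}" using that by simp
      ultimately show ?thesis by (auto simp: Plus_eq_empty_iff[of S])
    qed
    have swapJ': "swap_sides ` S \<in> ?J'" if "S \<in> ?J'" for S
    proof -
      have "swap_sides ` S \<notin> ?J" using swap[of "swap_sides ` S"] box0.image_image_simplex that by auto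
      then show ?thesis using that box0.image_simplex by auto
    qed
    show "continuous_map ?Y euclideanreal (\<lambda>x. y x)"
      unfolding y_def using finJ' box0.continuous_face_weight
      by (intro continuous_map_sum continuous_map_real_mult continuous_map_from_subtopology) auto
    show "y (?\<nu> x) = - y x" if x: "x \<in> topspace ?Y" for x
    proof -
      have "y (?\<nu> x) = (\<Sum>S\<in>?J'. sgn S * box0.fw (swap_sides ` S) x)"
        unfolding y_def using x by (intro sum.cong) (auto simp: box0.face_weight_affine_extension)
      also have "\<dots> = (\<Sum>S\<in>?J'. sgn (swap_sides ` S) * box0.fw S x)"
        by (rule sum.reindex_bij_witness[of _ "(`) swap_sides" "(`) swap_sides"])
          (use swapJ' box0.image_image_simplex in \<open>simp_all\<close>)
      also have "\<dots> = (\<Sum>S\<in>?J'. - (sgn S * box0.fw S x))"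
        by (rule sum.cong) (use side in \<open>auto simp: sgn_def\<close>)
      finally show ?thesis by (simp add: y_def sum_negf)
    qed
    fix x assume x: "x \<in> topspace ?Y"
    then obtain S where S: "S \<in> ?J'" "box0.fw S x \<noteq> 0" by auto
    have "sgn T = sgn S" if "T \<in> ?J'" "box0.fw T x \<noteq> 0" for T
    proof -
      have "T \<subseteq> S \<or> S \<subseteq> T"
        using that S by (intro face_weight_chain[OF box0.finite_vertices]) auto
      then show ?thesis using side[OF that(1)] side[OF S(1)] unfolding sgn_def
        by (metis empty_subsetI subset_antisym vimage_mono)
    qed
    then have "y x = (\<Sum>T\<in>?J'. sgn S * box0.fw T x)"
      unfolding y_def by (intro sum.cong refl) (metis mult_zero_right)
    then have "y x = sgn S * (\<Sum>T\<in>?J'. box0.fw T x)" by (simp add: sum_distrib_left)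
    moreover have "(\<Sum>T\<in>?J'. box0.fw T x) > 0"
      by (rule sum_pos2[OF finJ' S(1)]) (use x S box0.face_weight_nonneg[of x] in \<open>auto simp: less_le\<close>)
    ultimately show "\<exists>j\<in>{()}. y x \<noteq> 0" by (auto simp: sgn_def)
  qed simp
  have "complex_index (box_complex0 G) swap_sides \<le> z2_index (subtopology ?X {x. \<exists>S\<in>?J. box0.fw S x \<noteq> 0}) ?\<nu> +
     z2_index (subtopology ?X {x. \<exists>S\<in>?J'. box0.fw S x \<noteq> 0}) ?\<nu> + 1"
    by (rule box0.complex_index_le_join[OF J swap])
  also have "\<dots> \<le> complex_index (box_complex G) swap_sides + ereal (real (card {()}) - 1) + 1"
    by (intro add_mono A B order_refl)
  finally show ?thesis by (simp flip: zero_ereal_def)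
qed

end

lemma finite_loopless_kneser_graph:
  assumes "finite \<F>"
  shows "finite_loopless_graph (kneser_graph \<F>)"
  by unfold_locales (auto simp: kneser_graph_def assms doubleton_eq_iff)

section \<open>The cross-polytope, Sarkaria's inequality and the nonfaces\<close>

lemma z2_index_nsphere: "ereal (real m) \<le> z2_index (nsphere m) uminus"
proof (cases "nsphere m" "uminus :: (nat \<Rightarrow> real) \<Rightarrow> _" rule: z2_index_cases)
  case (finite k f)
  then have "m \<le> k" by (intro Borsuk_Ulam_nsphere[of m k f])
  then show ?thesis by (simp add: finite)
qed auto

text \<open>\<open>deleted_join (Pow {1..n})\<close> is the boundary of the cross-polytope. Positive
  and negative parts of the coordinates are the weights that map the sphere to it; at each point a
  coordinate has at most one nonzero part, which keeps the two sides disjoint.\<close>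

lemma complex_index_crosspolytope:
  assumes "n \<ge> 1"
  shows "ereal (real n - 1) \<le> complex_index (deleted_join (Pow {1..n})) swap_sides"
proof -
  \<comment> \<open>Sphere coordinates are numbered from 0 and vertices from 1, hence
    \<open>i - 1\<close>.\<close>
  define a where "a P x = (case P of Inl i \<Rightarrow> max 0 (x (i - 1)) | Inr i \<Rightarrow> max 0 (- x (i - 1)))"
    for P :: "nat + nat" and x :: "nat \<Rightarrow> real"
  let ?I = "{1..n} <+> {1..n}"
  have "ereal (real n - 1) \<le> z2_index (nsphere (n - 1)) uminus"
    using z2_index_nsphere[of "n - 1"] assms by (simp add: of_nat_diff)
  also have "\<dots> \<le> complex_index (deleted_join (Pow {1..n})) swap_sides"
  proof (rule z2_index_le_complex_index[where a = a and h = "\<lambda>P. {P}" and \<gamma> = swap_sides and I = ?I])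
    show "continuous_map (nsphere (n - 1)) euclideanreal (a P)" for P
      unfolding a_def
      by (cases P) (auto intro!: continuous_map_real_max continuous_map_nsphere_projection)
    show "a P (- x) = a (swap_sides P) x" for P x
      by (cases P) (auto simp: a_def)
    show "swap_sides P \<in> ?I" if "P \<in> ?I" for P
      using that by auto
    fix x :: "nat \<Rightarrow> real" assume x: "x \<in> topspace (nsphere (n - 1))"
    show "(\<Union>P\<in>{P \<in> ?I. a P x \<noteq> 0}. {P}) \<in> deleted_join (Pow {1..n})"
      by (auto simp: deleted_join_iff a_def max_def split: if_splits)
    have "(\<Sum>i\<le>n - 1. (x i)\<^sup>2) = 1" using x by (simp add: nsphere)
    then obtain i where i: "i \<le> n - 1" "x i \<noteq> 0"
      by (metis (no_types, lifting) atMost_iff power_zero_numeral sum.neutral zero_neq_one)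
    show "\<exists>P\<in>?I. a P x \<noteq> 0 \<and> {P} \<noteq> {}"
    proof (cases "x i > 0")
      case True
      then show ?thesis using i assms by (intro bexI[of _ "Inl (Suc i)"]) (auto simp: a_def)
    next
      case False
      then show ?thesis using i assms by (intro bexI[of _ "Inr (Suc i)"]) (auto simp: a_def)
    qed
  qed (auto simp: a_def split: sum.split)
  finally show ?thesis .
qed

locale set_family =
  fixes n :: nat and \<F> :: "nat set set"
  assumes family_subset: "\<F> \<subseteq> Pow {1..n}" and empty: "{} \<notin> \<F>"
begin

lemma free_complex_down_closed: "S \<in> free_complex n \<F> \<Longrightarrow> T \<subseteq> S \<Longrightarrow> T \<in> free_complex n \<F>"
  unfolding free_complex_def mem_Collect_eq by (meson order_trans)

abbreviation "K \<equiv> free_complex n \<F>"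
abbreviation "nonfaces \<equiv> deleted_join (Pow {1..n}) - deleted_join K"

lemma finite_family: "finite \<F>"
  using family_subset by (rule finite_subset) simp

sublocale graph: finite_loopless_graph "kneser_graph \<F>"
  by (rule finite_loopless_kneser_graph[OF finite_family])

sublocale cross: z2_complex "deleted_join (Pow {1..n})" swap_sides
  by (rule z2_complex_deleted_join[of "{1..n}"]) auto

sublocale free: z2_complex "deleted_join K" swap_sides
  by (rule z2_complex_deleted_join[of "{1..n}"]) (simp, simp add: free_complex_def, rule free_complex_down_closed)

lemma empty_free: "{} \<in> deleted_join K"
  using empty by (auto simp: deleted_join_iff free_complex_def)

lemma free_subset_cross: "deleted_join K \<subseteq> deleted_join (Pow {1..n})"
  by (auto simp: deleted_join_iff free_complex_def)

lemma nonfaces_minus_empty: "nonfaces - {{}} = nonfaces"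
  using empty_free by auto

lemma swap_nonface: "swap_sides ` S \<in> nonfaces" if "S \<in> nonfaces"
  using that by (auto simp: deleted_join_iff)

lemma swap_swap_image: "swap_sides ` swap_sides ` S = S"
  by (simp add: image_image)

sublocale nonface: z2_complex "order_complex nonfaces" "(`) swap_sides"
  by (rule z2_complex_order_complex)
    (use cross.finite_complex swap_nonface in \<open>auto simp: nonfaces_minus_empty swap_swap_image simp del: Diff_iff\<close>)

text \<open>The nonempty faces of the cross-polytope boundary split into those of
  \<open>deleted_join K\<close> and the nonfaces. In the first family a chain goes to its greatest
  face; in the second a chain is itself a simplex of the order complex.\<close>

lemma Sarkaria_inequality:
  assumes "n \<ge> 1"
  shows "ereal (real n - 1) \<le> complex_index (deleted_join K) swap_sides
     + complex_index (order_complex nonfaces) ((`) swap_sides) + 1"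
proof -
  let ?X = "polyhedron_of (deleted_join (Pow {1..n}))"
  let ?\<nu> = "affine_extension swap_sides :: (nat + nat \<Rightarrow> real) \<Rightarrow> _"
  let ?J = "deleted_join K - {{}}"
  have J': "deleted_join (Pow {1..n}) - {{}} - ?J = nonfaces"
    using empty_free by auto
  have J: "?J \<subseteq> deleted_join (Pow {1..n}) - {{}}" using free_subset_cross by auto
  have swap: "swap_sides ` S \<in> ?J" if "S \<in> ?J" for S using that free.image_simplex by auto
  have A: "z2_index (subtopology ?X {x. \<exists>S\<in>?J. cross.fw S x \<noteq> 0}) ?\<nu> \<le> complex_index (deleted_join K) swap_sides"
  proof (rule cross.z2_index_faces_le[where h = "\<lambda>S. S", OF J swap])
    show "finite S" if "S \<in> ?J" for S
      using that free.finite_vertices finite_subset by (metis DiffD1 Sup_upper)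
    show "\<Union>((\<lambda>S. S) ` C) \<in> deleted_join K" if "C \<subseteq> ?J" "C \<noteq> {}" "finite C" "chain\<^sub>\<subseteq> C" for C
      using finite_chain_extrema(1)[of C] that by auto
  qed auto
  have B: "z2_index (subtopology ?X {x. \<exists>S\<in>nonfaces. cross.fw S x \<noteq> 0}) ?\<nu>
     \<le> complex_index (order_complex nonfaces) ((`) swap_sides)"
  proof (rule cross.z2_index_faces_le[where h = "\<lambda>S. {S}"])
    show "nonfaces \<subseteq> deleted_join (Pow {1..n}) - {{}}" using empty_free by auto
    show "\<Union>((\<lambda>S. {S}) ` C) \<in> order_complex nonfaces" if "C \<subseteq> nonfaces" "finite C" "chain\<^sub>\<subseteq> C" for C
      using that unfolding order_complex_def nonfaces_minus_empty by simp
  qed (use swap_nonface in \<open>auto simp: swap_swap_image simp del: Diff_iff\<close>)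
  have "ereal (real n - 1) \<le> complex_index (deleted_join (Pow {1..n})) swap_sides"
    by (rule complex_index_crosspolytope[OF assms])
  also have "\<dots> \<le> z2_index (subtopology ?X {x. \<exists>S\<in>?J. cross.fw S x \<noteq> 0}) ?\<nu> +
     z2_index (subtopology ?X {x. \<exists>S\<in>nonfaces. cross.fw S x \<noteq> 0}) ?\<nu> + 1"
    using cross.complex_index_le_join[OF J swap] unfolding J' .
  also have "\<dots> \<le> complex_index (deleted_join K) swap_sides
     + complex_index (order_complex nonfaces) ((`) swap_sides) + 1"
    by (intro add_mono A B order_refl)
  finally show ?thesis .
qed

lemma edges_kneser: "{A, B} \<in> edges (kneser_graph \<F>) \<longleftrightarrow> A \<in> \<F> \<and> B \<in> \<F> \<and> A \<inter> B = {}"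
proof -
  have "A \<noteq> B" if "A \<in> \<F>" "A \<inter> B = {}" using that empty by auto
  then show ?thesis by (auto simp: kneser_graph_def doubleton_eq_iff)
qed

lemma box_complex0_kneser_iff:
  "S \<in> box_complex0 (kneser_graph \<F>) \<longleftrightarrow> Inl -` S \<subseteq> \<F> \<and> Inr -` S \<subseteq> \<F> \<and> (\<forall>A\<in>Inl -` S. \<forall>B\<in>Inr -` S. A \<inter> B = {})"
proof -
  have V: "verts (kneser_graph \<F>) = \<F>" by (simp add: kneser_graph_def)
  have "A \<subseteq> \<F> \<and> B \<subseteq> \<F> \<and> B \<subseteq> CN (kneser_graph \<F>) A \<longleftrightarrow>
      A \<subseteq> \<F> \<and> B \<subseteq> \<F> \<and> (\<forall>X\<in>A. \<forall>Y\<in>B. X \<inter> Y = {})" for A B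
    unfolding CN_def edges_kneser V by (rule iffI; safe; blast)
  then show ?thesis unfolding graph.box_complex0_iff V .
qed

lemma nonfaces_iff:
  "S \<in> nonfaces \<longleftrightarrow> Inl -` S \<subseteq> {1..n} \<and> Inr -` S \<subseteq> {1..n} \<and> Inl -` S \<inter> Inr -` S = {} \<and>
     ((\<exists>F\<in>\<F>. F \<subseteq> Inl -` S) \<or> (\<exists>F\<in>\<F>. F \<subseteq> Inr -` S))"
  by (auto simp: deleted_join_iff free_complex_def simp del: vimage_eq)

text \<open>Uniting the sets on each side keeps the sides disjoint, because sets from different
  sides are. For a nonempty face one of the unions contains a member of \<open>\<F>\<close>, which
  makes the result a nonface.\<close>

lemma complex_index_box0_le_nonfaces:
  "complex_index (box_complex0 (kneser_graph \<F>)) swap_sides \<le> complex_index (order_complex nonfaces) ((`) swap_sides)"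
proof -
  define u where "u S = \<Union>(Inl -` S) <+> \<Union>(Inr -` S)" for S :: "(nat set + nat set) set"
  have u_mono: "u S \<subseteq> u T" if "S \<subseteq> T" for S T
    using that by (auto simp: u_def)
  have u: "u S \<in> nonfaces" if "S \<in> box_complex0 (kneser_graph \<F>) - {{}}" for S
  proof -
    define A B where "A = Inl -` S" and "B = Inr -` S"
    have S: "A \<subseteq> \<F>" "B \<subseteq> \<F>" "\<forall>X\<in>A. \<forall>Y\<in>B. X \<inter> Y = {}"
      using that box_complex0_kneser_iff[of S] by (simp_all add: A_def B_def)
    have "A \<noteq> {} \<or> B \<noteq> {}"
      using that Plus_eq_empty_iff[of S] by (simp add: A_def B_def)
    then have "(\<exists>F\<in>\<F>. F \<subseteq> \<Union>A) \<or> (\<exists>F\<in>\<F>. F \<subseteq> \<Union>B)"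
      using S(1,2) by blast
    moreover have "\<Union>A \<subseteq> {1..n}" "\<Union>B \<subseteq> {1..n}" using S(1,2) family_subset by blast+
    moreover have "\<Union>A \<inter> \<Union>B = {}" using S(3) by blast
    ultimately show ?thesis unfolding nonfaces_iff u_def vimage_Plus A_def B_def by simp
  qed
  show ?thesis
  proof (rule graph.box0.complex_index_le[where h = "\<lambda>S. {u S}"])
    show "{u (swap_sides ` S)} = (`) swap_sides ` {u S}" for S by (simp add: u_def)
    fix C assume C: "C \<subseteq> box_complex0 (kneser_graph \<F>) - {{}}" "finite C" "chain\<^sub>\<subseteq> C"
    have "chain\<^sub>\<subseteq> (u ` C)"
      unfolding chain_subset_def
    proof (intro ballI)
      fix X Y assume "X \<in> u ` C" "Y \<in> u ` C"
      then obtain S T where "X = u S" "Y = u T" "S \<in> C" "T \<in> C" by blast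
      moreover from this have "S \<subseteq> T \<or> T \<subseteq> S" using C(3) by (simp add: chain_subset_def)
      ultimately show "X \<subseteq> Y \<or> Y \<subseteq> X" using u_mono by auto
    qed
    moreover have "u ` C \<subseteq> nonfaces" using C(1) u by blast
    moreover have "(\<Union>S\<in>C. {u S}) = u ` C" by blast
    ultimately show "(\<Union>S\<in>C. {u S}) \<in> order_complex nonfaces"
      using C(2) unfolding order_complex_def nonfaces_minus_empty by simp
  qed (simp_all add: swap_swap_image)
qed

text \<open>The map back collects, for each side, the members of \<open>\<F>\<close> contained in
  it; disjoint sides make them adjacent. It is monotone, so a whole chain is sent to the simplex of
  its greatest member.\<close>

lemma complex_index_nonfaces_le_box0:
  "complex_index (order_complex nonfaces) ((`) swap_sides) \<le> complex_index (box_complex0 (kneser_graph \<F>)) swap_sides"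
proof -
  define w where "w U = {F \<in> \<F>. F \<subseteq> Inl -` U} <+> {F \<in> \<F>. F \<subseteq> Inr -` U}" for U :: "(nat + nat) set"
  have w_mono: "w U \<subseteq> w U'" if "U \<subseteq> U'" for U U'
    using that by (auto simp: w_def)
  have w: "w U \<in> box_complex0 (kneser_graph \<F>)" "w U \<noteq> {}" if "U \<in> nonfaces" for U
    using that unfolding nonfaces_iff box_complex0_kneser_iff Plus_eq_empty_iff[of "w U"] w_def vimage_Plus
    by blast+
  have top: "\<Union>C \<in> C" "\<Union>C \<in> nonfaces" if "C \<in> order_complex nonfaces - {{}}" for C
  proof -
    have "finite C" "C \<noteq> {}" "chain\<^sub>\<subseteq> C" "C \<subseteq> nonfaces"
      using that unfolding order_complex_def nonfaces_minus_empty by auto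
    then show "\<Union>C \<in> C" "\<Union>C \<in> nonfaces" using finite_chain_extrema(1)[of C] by blast+
  qed
  show ?thesis
  proof (rule nonface.complex_index_le[where h = "\<lambda>C. w (\<Union>C)"])
    fix C assume C: "C \<in> order_complex nonfaces - {{}}"
    show "finite (w (\<Union>C))" using finite_family by (simp add: w_def)
    show "w (\<Union>C) \<noteq> {}" using w top[OF C] by blast
    have "\<Union>((`) swap_sides ` C) = swap_sides ` \<Union>C" by blast
    then show "w (\<Union>((`) swap_sides ` C)) = swap_sides ` w (\<Union>C)" by (simp add: w_def)
  next
    fix \<D> assume \<D>: "\<D> \<subseteq> order_complex nonfaces - {{}}" "\<D> \<noteq> {}" "finite \<D>" "chain\<^sub>\<subseteq> \<D>"
    then have D: "\<Union>\<D> \<in> \<D>" by (intro finite_chain_extrema)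
    then have "(\<Union>C\<in>\<D>. w (\<Union>C)) = w (\<Union>(\<Union>\<D>))"
      using w_mono[OF Union_mono[OF Union_upper]] by blast
    then show "(\<Union>C\<in>\<D>. w (\<Union>C)) \<in> box_complex0 (kneser_graph \<F>)"
      using w(1)[OF top(2)] D \<D>(1) by (simp only: subset_iff)
  qed auto
qed

end

section \<open>Upper bounds on the index from colourings and from the dimension\<close>

lemma affine_extension_swap_sides [simp]: "affine_extension swap_sides x v = x (swap_sides v)"
proof -
  have "{u. x u \<noteq> 0 \<and> swap_sides u = v} = (if x (swap_sides v) = 0 then {} else {swap_sides v})"
    by auto
  then show ?thesis by (simp add: affine_extension_def)
qed

text \<open>Every point of the polyhedron is positive on some colour class and vanishes on another one; so
  the differences of the coordinates over colour classes have no common zero.\<close>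

lemma (in finite_loopless_graph) complex_index_box_le_coloring:
  assumes c: "c ` verts G \<subseteq> {..m}" and proper: "\<And>v w. v \<in> verts G \<Longrightarrow> w \<in> verts G \<Longrightarrow> {v, w} \<in> edges G \<Longrightarrow> c v \<noteq> c w"
  shows "complex_index (box_complex G) swap_sides \<le> ereal (real m - 1)"
proof -
  define y where "y i x = (\<Sum>v\<in>{v \<in> verts G. c v = i}. x (Inl v) - x (Inr v))" for i :: nat and x :: "'a + 'a \<Rightarrow> real"
  let ?X = "polyhedron_of (box_complex G)"
  have "z2_index ?X (affine_extension swap_sides) \<le> ereal (real (card {..<m}) - 1)"
  \<comment> \<open>The \<open>m + 1\<close> colour sums are compared with the last one, which
    leaves \<open>m\<close> functions.\<close>
  proof (rule z2_index_le_nonvanishing[where y = "\<lambda>i x. y i x - y m x"])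
    have "continuous_map ?X euclideanreal (y i)" for i
      unfolding y_def using finite_verts
      by (intro continuous_map_sum continuous_map_diff continuous_map_polyhedron_coordinate) auto
    then show "continuous_map ?X euclideanreal (\<lambda>x. y i x - y m x)" for i
      by (intro continuous_map_diff)
    have "y i (affine_extension swap_sides x) = - y i x" for i x
      by (simp add: y_def flip: sum_negf)
    then show "y i (affine_extension swap_sides x) - y m (affine_extension swap_sides x) = - (y i x - y m x)" for i x
      by simp
    fix x assume "x \<in> topspace ?X"
    define A B where "A = {v. x (Inl v) \<noteq> 0}" and "B = {v. x (Inr v) \<noteq> 0}"
    have x0: "\<And>v. 0 \<le> x v" and S: "{v. x v \<noteq> 0} \<in> box_complex G" and sum1: "(\<Sum>v | x v \<noteq> 0. x v) = 1"
      using \<open>x \<in> topspace ?X\<close> by (auto simp: topspace_polyhedron_of)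
    have AB: "A \<subseteq> verts G" "B \<subseteq> verts G" "B \<subseteq> cn A" "cn A \<noteq> {}" "cn B \<noteq> {}"
      using S by (simp_all add: box_complex_iff A_def B_def vimage_def)
    have "A \<subseteq> cn B" using AB subset_cn_cn cn_antimono by blast
    have adj: "c v \<noteq> c w" if "v \<in> C" "w \<in> cn C" "C \<subseteq> verts G" for C v w
      using that proper[of v w] by (auto simp: CN_def)
    \<comment> \<open>The colour of \<open>w \<in> cn A\<close> does not occur in \<open>A\<close>,
      so only the negative terms from \<open>B\<close> remain in its colour sum.\<close>
    have neg: "y (c w) x \<le> 0" "y (c w) x = 0 \<Longrightarrow> w \<notin> B" if w: "w \<in> cn A" for w
    proof -
      have "x (Inl v) = 0" if "c v = c w" for v
        using adj[of v A w] w AB(1) that by (auto simp: A_def)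
      then have "y (c w) x = - (\<Sum>v\<in>{v \<in> verts G. c v = c w}. x (Inr v))"
        unfolding y_def sum_negf[symmetric] by (intro sum.cong) auto
      moreover have "(\<Sum>v\<in>{v \<in> verts G. c v = c w}. x (Inr v)) > 0" if "w \<in> B"
        by (rule sum_pos2[of _ w]) (use that AB(2) x0 finite_verts in \<open>auto simp: B_def less_le\<close>)
      ultimately show "y (c w) x \<le> 0" "y (c w) x = 0 \<Longrightarrow> w \<notin> B"
        using x0 by (auto simp: sum_nonneg)
    qed
    have pos: "y (c w) x \<ge> 0" "y (c w) x = 0 \<Longrightarrow> w \<notin> A" if w: "w \<in> cn B" for w
    proof -
      have "x (Inr v) = 0" if "c v = c w" for v
        using adj[of v B w] w AB(2) that by (auto simp: B_def)
      then have "y (c w) x = (\<Sum>v\<in>{v \<in> verts G. c v = c w}. x (Inl v))"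
        unfolding y_def by (intro sum.cong) auto
      moreover have "(\<Sum>v\<in>{v \<in> verts G. c v = c w}. x (Inl v)) > 0" if "w \<in> A"
        by (rule sum_pos2[of _ w]) (use that AB(1) x0 finite_verts in \<open>auto simp: A_def less_le\<close>)
      ultimately show "y (c w) x \<ge> 0" "y (c w) x = 0 \<Longrightarrow> w \<notin> A"
        using x0 by (auto simp: sum_nonneg)
    qed
    show "\<exists>i\<in>{..<m}. y i x - y m x \<noteq> 0"
    proof (rule ccontr)
      assume "\<not> ?thesis"
      \<comment> \<open>If all colour sums agree, the common value is at most 0 because of
        \<open>cn A\<close> and at least 0 because of \<open>cn B\<close>. So all sums vanish, which
        leaves no vertex in \<open>A\<close> or \<open>B\<close>.\<close>
      then have const: "y i x = y m x" if "i \<le> m" for i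
        using that by (cases "i = m") auto
      have cm: "c w \<le> m" if "w \<in> cn C" for w C
        using that c cn_subset by blast
      obtain w w' where "w \<in> cn A" "w' \<in> cn B" using AB by blast
      then have "y m x = 0"
        using neg(1)[of w] pos(1)[of w'] const cm by (metis order_antisym)
      then have zero: "y (c w) x = 0" if "w \<in> cn C" for w C
        using const[OF cm[OF that]] by simp
      have "A = {}" "B = {}"
        using pos(2)[OF _ zero] neg(2)[OF _ zero] \<open>A \<subseteq> cn B\<close> AB(3) by (meson all_not_in_conv subsetD)+
      then have "x v = 0" for v by (cases v) (auto simp: A_def B_def)
      then show False using sum1 by simp
    qed
  qed auto
  then show ?thesis by (simp add: complex_index_def)
qed

lemma (in z2_complex) card_image_simplex: "S \<in> K \<Longrightarrow> card (g ` S) = card S"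
  using involution by (intro card_image inj_on_inverseI[of _ g]) auto

text \<open>Chains of faces contain at most one face of every cardinality.\<close>

lemma (in z2_complex) complex_index_le_dim:
  fixes sgn :: "'v set \<Rightarrow> real"
  assumes sgn: "\<And>S. S \<in> K - {{}} \<Longrightarrow> sgn S \<noteq> 0 \<and> sgn (g ` S) = - sgn S" and ne: "K \<noteq> {}"
  shows "complex_index K g \<le> ereal (real_of_int (complex_dim K))"
proof -
  \<comment> \<open>The largest cardinality of a face; the coordinates of the odd map are indexed by
    the cardinalities from 1 to \<open>N\<close>.\<close>
  define N where "N = nat (complex_dim K + 1)"
  have le: "int (card S) \<le> complex_dim K + 1" if "S \<in> K" for S
    using Max_ge[OF finite_imageI[OF finite_complex] imageI[OF that], of "\<lambda>S. int (card S) - 1"]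
    by (simp add: complex_dim_def)
  have N: "int N = complex_dim K + 1" using le ne by (force simp: N_def)
  define F where "F i = {S \<in> K - {{}}. card S = i}" for i
  have finF: "finite (F i)" for i using finite_complex by (simp add: F_def)
  define y where "y i x = (\<Sum>S\<in>F i. sgn S * fw S x)" for i x
  have "z2_index (polyhedron_of K) (affine_extension g) \<le> ereal (real (card {1..N}) - 1)"
  proof (rule z2_index_le_nonvanishing[where y = y])
    show "continuous_map (polyhedron_of K) euclideanreal (y i)" for i
      unfolding y_def
      by (intro continuous_map_sum finF continuous_map_real_mult continuous_face_weight) (auto simp: F_def)
    fix x assume x: "x \<in> topspace (polyhedron_of K)"
    show "y i (affine_extension g x) = - y i x" for i
    proof -
      have "y i (affine_extension g x) = (\<Sum>S\<in>F i. sgn S * fw (g ` S) x)"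
        unfolding y_def using face_weight_affine_extension[OF x] by (intro sum.cong) (auto simp: F_def)
      also have "\<dots> = (\<Sum>S\<in>F i. sgn (g ` S) * fw S x)"
        by (rule sum.reindex_bij_witness[of _ "(`) g" "(`) g"])
          (auto simp: F_def image_image_simplex card_image_simplex image_simplex)
      also have "\<dots> = (\<Sum>S\<in>F i. - (sgn S * fw S x))"
        by (rule sum.cong) (auto simp: F_def sgn)
      finally show ?thesis by (simp add: y_def sum_negf)
    qed
    obtain S where S: "S \<in> K - {{}}" "fw S x \<noteq> 0" using ex_face_weight_nonzero[OF x] by blast
    have fin: "finite T" if "T \<in> K" for T using that finite_vertices by (meson Sup_upper finite_subset)
    have "fw T x = 0" if "T \<in> F (card S) - {S}" for T
    proof (rule ccontr)
      assume "fw T x \<noteq> 0"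
      then have "T \<subseteq> S \<or> S \<subseteq> T"
        using that S by (intro face_weight_chain[OF finite_vertices]) (auto simp: F_def)
      then show False
        using that S fin[of S] fin[of T] card_subset_eq by (auto simp: F_def) metis+
    qed
    then have "y (card S) x = (\<Sum>T\<in>{S}. sgn T * fw T x)"
      unfolding y_def using S finF by (intro sum.mono_neutral_right) (auto simp: F_def)
    then have "y (card S) x \<noteq> 0" using S sgn by simp
    moreover have "card S \<in> {1..N}"
      using le[of S] N S fin[of S] by (auto simp: Suc_le_eq card_gt_0_iff)
    ultimately show "\<exists>i\<in>{1..N}. y i x \<noteq> 0" by blast
  qed auto
  also have "real (card {1..N}) - 1 = real_of_int (complex_dim K)" using N by simp
  finally show ?thesis by (simp add: complex_index_def)
qed

text \<open>The least vertex of a nonempty face occurs on exactly one side, and the swap moves it to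
  the other; its side is the odd sign.\<close>

lemma complex_index_deleted_join_le_dim:
  fixes L :: "'v::linorder set set"
  assumes V: "finite V" "\<And>S. S \<in> L \<Longrightarrow> S \<subseteq> V" "\<And>S T. S \<in> L \<Longrightarrow> T \<subseteq> S \<Longrightarrow> T \<in> L" and ne: "deleted_join L \<noteq> {}"
  shows "complex_index (deleted_join L) swap_sides \<le> ereal (real_of_int (complex_dim (deleted_join L)))"
proof -
  define sgn :: "('v + 'v) set \<Rightarrow> real" where "sgn S = (if Min (Inl -` S \<union> Inr -` S) \<in> Inl -` S then 1 else - 1)" for S
  interpret z2_complex "deleted_join L" swap_sides using V by (rule z2_complex_deleted_join)
  show ?thesis
  proof (rule complex_index_le_dim[of sgn, OF _ ne])
    fix S assume S: "S \<in> deleted_join L - {{}}"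
    define A B where "A = Inl -` S" and "B = Inr -` S"
    have "A \<in> L" "B \<in> L" and disj: "A \<inter> B = {}" and ne: "A \<union> B \<noteq> {}"
      using S Plus_eq_empty_iff[of S] by (auto simp: deleted_join_iff A_def B_def)
    then have "A \<union> B \<subseteq> V" using V(2) by simp
    then have "finite (A \<union> B)" using V(1) by (rule finite_subset)
    then have "Min (A \<union> B) \<in> A \<union> B" using ne by (rule Min_in)
    moreover have "sgn (swap_sides ` S) = (if Min (A \<union> B) \<in> B then 1 else - 1)" "sgn S = (if Min (A \<union> B) \<in> A then 1 else - 1)"
      by (simp_all add: sgn_def A_def B_def Un_commute del: vimage_eq)
    ultimately show "sgn S \<noteq> 0 \<and> sgn (swap_sides ` S) = - sgn S"
      using disj by auto
  qed
qed

section \<open>Embeddings into the boundary of a polytope\<close>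

lemma rel_frontier_ray_unique:
  fixes P :: "'e::euclidean_space set"
  assumes P: "convex P" "a \<in> rel_interior P" and p: "p \<in> rel_frontier P" and q: "q \<in> rel_frontier P"
    and st: "s > 0" "t > 0" and eq: "s *\<^sub>R (p - a) = t *\<^sub>R (q - a)"
  shows "p = q"
proof -
  have *: False if "p \<in> rel_frontier P" "q \<in> rel_frontier P" "0 < s" "s < t" "s *\<^sub>R (p - a) = t *\<^sub>R (q - a)"
    for p q s t
  proof -
    have "(s / t) *\<^sub>R (p - a) = (1 / t) *\<^sub>R (s *\<^sub>R (p - a))" by simp
    also have "\<dots> = q - a" using that by simp
    finally have q: "q = (1 - s / t) *\<^sub>R a + (s / t) *\<^sub>R p" by (simp add: algebra_simps)
    have "a \<noteq> p" using that P by (auto simp: rel_frontier_def)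
    \<comment> \<open>For \<open>s < t\<close> the point \<open>q\<close> is strictly closer to
      \<open>a\<close>, and a segment from a relative interior point meets the frontier only at its
      far end.\<close>
    then have "q \<in> open_segment a p"
      unfolding in_segment using that q by (intro conjI exI[of _ "s / t"]) auto
    also have "\<dots> \<subseteq> rel_interior P"
      using that by (intro rel_interior_closure_convex_segment P) (simp add: rel_frontier_def)
    finally show False using that by (simp add: rel_frontier_def)
  qed
  have "s = t"
    using *[OF p q st(1) _ eq] *[OF q p st(2) _ eq[symmetric]] by (meson linorder_neqE_linordered_idom)
  then show ?thesis using eq st by simp
qed

text \<open>The intersection is a face of both hulls. If it is nonempty, it has an extreme point,
  which is extreme in both hulls and hence a common vertex.\<close>

lemma simplicial_complex_disjoint_hulls:
  fixes \<phi> :: "'v \<Rightarrow> 'e::euclidean_space"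
  assumes \<C>: "simplicial_complex \<C>" "convex hull (\<phi> ` S) \<in> \<C>" "convex hull (\<phi> ` T) \<in> \<C>"
    and indep: "\<not> affine_dependent (\<phi> ` S)" "\<not> affine_dependent (\<phi> ` T)"
    and disj: "\<phi> ` S \<inter> \<phi> ` T = {}"
  shows "convex hull (\<phi> ` S) \<inter> convex hull (\<phi> ` T) = {}"
proof (rule ccontr)
  let ?F = "convex hull (\<phi> ` S) \<inter> convex hull (\<phi> ` T)"
  assume ne: "?F \<noteq> {}"
  have "?F face_of convex hull (\<phi> ` S)" "?F face_of convex hull (\<phi> ` T)"
    using \<C> unfolding simplicial_complex_def by (metis Int_commute)+
  then have face: "?F face_of convex hull (\<phi> ` S)" "?F face_of convex hull (\<phi> ` T)" .
  have F: "compact ?F" "convex ?F"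
    using indep by (simp_all add: compact_Int compact_convex_hull finite_imp_compact aff_independent_finite convex_Int)
  obtain e where e: "e extreme_point_of ?F" by (rule extreme_point_exists_convex[OF F ne])
  have "e \<in> \<phi> ` S" "e \<in> \<phi> ` T"
    using extreme_point_of_face[OF face(1)] extreme_point_of_face[OF face(2)] e
    by (auto dest: extreme_point_of_convex_hull)
  then show False using disj by blast
qed

context set_family
begin

text \<open>Seen from an interior point \<open>a\<close>, the odd map \<open>z\<close> subtracts the
  two parts of \<open>x\<close> as vectors. At a zero with both parts present, two frontier points
  in the hulls of disjoint simplices lie on one ray from \<open>a\<close>, hence coincide. The
  values lie in the direction space of \<open>P\<close>, so \<open>aff_dim P\<close> counts the
  coordinates.\<close>

lemma complex_index_free_le_polytope:
  fixes P :: "'e::euclidean_space set" and \<phi> :: "nat \<Rightarrow> 'e"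
  assumes P: "polytope P" and inj: "inj_on \<phi> {1..n}" and \<phi>: "\<And>i. i \<in> {1..n} \<Longrightarrow> \<phi> i \<in> P" and n: "n \<ge> 1"
    and indep: "\<And>S. S \<in> K \<Longrightarrow> \<not> affine_dependent (\<phi> ` S)"
    and bdry: "\<And>S. S \<in> K \<Longrightarrow> convex hull (\<phi> ` S) \<subseteq> rel_frontier P"
    and sc: "simplicial_complex ((\<lambda>S. convex hull (\<phi> ` S)) ` K)"
  shows "complex_index (deleted_join K) swap_sides \<le> ereal (real_of_int (aff_dim P - 1))"
proof -
  let ?X = "polyhedron_of (deleted_join K)"
  have conv: "convex P" using P by (rule polytope_imp_convex)
  have "P \<noteq> {}" using \<phi>[of 1] n by auto
  then obtain a where a: "a \<in> rel_interior P" using rel_interior_eq_empty[OF conv] by blast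
  then have aP: "a \<in> P" using rel_interior_subset by blast
  define W where "W = span ((\<lambda>x. x - a) ` P)"
  have dimW: "int (dim W) = aff_dim P"
    using aff_dim_eq_dim_subtract[of a P] aP by (simp add: W_def dim_span hull_inc)
  obtain B where B: "independent B" "card B = dim W" "span B = W"
    using orthonormal_basis_subspace[of W] by (metis W_def subspace_span)
  have finB: "finite B" using B(1) by (rule independent_imp_finite)
  define z where "z x = (\<Sum>i\<in>{1..n}. (x (Inl i) - x (Inr i)) *\<^sub>R (\<phi> i - a))" for x :: "nat + nat \<Rightarrow> real"
  have zW: "z x \<in> W" for x
    unfolding z_def W_def by (intro span_sum span_scale span_base) (use \<phi> in auto)
  have z0: "z x \<noteq> 0" if x: "x \<in> topspace ?X" for x
  proof
    assume z: "z x = 0"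
    define S T where "S = {i. x (Inl i) \<noteq> 0}" and "T = {i. x (Inr i) \<noteq> 0}"
    have x0: "\<And>v. 0 \<le> x v" and supp: "{v. x v \<noteq> 0} \<in> deleted_join K" and sum1: "(\<Sum>v | x v \<noteq> 0. x v) = 1"
      using x by (auto simp: topspace_polyhedron_of)
    have ST: "S \<in> K" "T \<in> K" "S \<inter> T = {}"
      using supp by (simp_all add: deleted_join_iff S_def T_def vimage_def)
    then have sub: "S \<subseteq> {1..n}" "T \<subseteq> {1..n}" by (auto simp: free_complex_def)
    then have fin: "finite S" "finite T" using finite_subset by blast+
    define s t where "s = (\<Sum>i\<in>S. x (Inl i))" and "t = (\<Sum>i\<in>T. x (Inr i))"
    have "{v. x v \<noteq> 0} = S <+> T"
      using Plus_vimage[of "{v. x v \<noteq> 0}"] by (simp add: S_def T_def vimage_def)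
    then have st1: "s + t = 1" using sum1 fin by (simp add: s_def t_def sum.Plus)
    have st0: "s \<ge> 0" "t \<ge> 0" using x0 by (auto simp: s_def t_def sum_nonneg)
    \<comment> \<open>Normalised weights form a convex combination, so each side is a positive
      multiple of the vector from \<open>a\<close> to a point of its hull.\<close>
    have part: "\<exists>p\<in>convex hull (\<phi> ` R). (\<Sum>i\<in>R. r i *\<^sub>R (\<phi> i - a)) = sum r R *\<^sub>R (p - a)"
      if R: "finite R" "sum r R > 0" "\<And>i. 0 \<le> r i" for R and r :: "nat \<Rightarrow> real"
    proof
      let ?p = "\<Sum>i\<in>R. (r i / sum r R) *\<^sub>R \<phi> i"
      show "?p \<in> convex hull (\<phi> ` R)"
        using R by (intro convex_sum convex_convex_hull) (auto simp: hull_inc simp flip: sum_divide_distrib)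
      show "(\<Sum>i\<in>R. r i *\<^sub>R (\<phi> i - a)) = sum r R *\<^sub>R (?p - a)"
        using R by (simp add: scaleR_diff_right sum_subtractf scaleR_sum_right flip: scaleR_sum_left)
    qed
    have "z x = (\<Sum>i\<in>{1..n}. x (Inl i) *\<^sub>R (\<phi> i - a)) - (\<Sum>i\<in>{1..n}. x (Inr i) *\<^sub>R (\<phi> i - a))"
      by (simp add: z_def scaleR_diff_left sum_subtractf)
    also have "(\<Sum>i\<in>{1..n}. x (Inl i) *\<^sub>R (\<phi> i - a)) = (\<Sum>i\<in>S. x (Inl i) *\<^sub>R (\<phi> i - a))"
      by (rule sum.mono_neutral_right) (use sub in \<open>auto simp: S_def\<close>)
    also have "(\<Sum>i\<in>{1..n}. x (Inr i) *\<^sub>R (\<phi> i - a)) = (\<Sum>i\<in>T. x (Inr i) *\<^sub>R (\<phi> i - a))"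
      by (rule sum.mono_neutral_right) (use sub in \<open>auto simp: T_def\<close>)
    finally have eq: "(\<Sum>i\<in>S. x (Inl i) *\<^sub>R (\<phi> i - a)) = (\<Sum>i\<in>T. x (Inr i) *\<^sub>R (\<phi> i - a))"
      using z by simp
    have a_not: "a \<notin> convex hull (\<phi> ` R)" if "R \<in> K" for R
      using bdry[OF that] a by (auto simp: rel_frontier_def)
    \<comment> \<open>If one side carries no weight, the other one would put \<open>a\<close> itself
      into a hull on the frontier.\<close>
    consider "s = 0" | "t = 0" | "s > 0" "t > 0" using st0 by linarith
    then show False
    proof cases
      case 1
      then have "\<forall>i\<in>S. x (Inl i) = 0" using fin x0 by (simp add: s_def sum_nonneg_eq_0_iff)
      moreover have "t = 1" using 1 st1 by simp
      ultimately obtain p where "p \<in> convex hull (\<phi> ` T)" "p - a = 0"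
        using part[of T "\<lambda>i. x (Inr i)"] fin x0 eq by (auto simp: t_def[symmetric])
      then show False using a_not[OF ST(2)] by simp
    next
      case 2
      then have "\<forall>i\<in>T. x (Inr i) = 0" using fin x0 by (simp add: t_def sum_nonneg_eq_0_iff)
      moreover have "s = 1" using 2 st1 by simp
      ultimately obtain p where "p \<in> convex hull (\<phi> ` S)" "p - a = 0"
        using part[of S "\<lambda>i. x (Inl i)"] fin x0 eq by (auto simp: s_def[symmetric])
      then show False using a_not[OF ST(1)] by simp
    next
      case 3
      obtain p where p: "p \<in> convex hull (\<phi> ` S)" "(\<Sum>i\<in>S. x (Inl i) *\<^sub>R (\<phi> i - a)) = s *\<^sub>R (p - a)"
        using part[of S "\<lambda>i. x (Inl i)"] fin x0 3 by (auto simp: s_def)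
      obtain q where q: "q \<in> convex hull (\<phi> ` T)" "(\<Sum>i\<in>T. x (Inr i) *\<^sub>R (\<phi> i - a)) = t *\<^sub>R (q - a)"
        using part[of T "\<lambda>i. x (Inr i)"] fin x0 3 by (auto simp: t_def)
      have "p = q"
      proof (rule rel_frontier_ray_unique[OF conv a _ _ 3])
        show "p \<in> rel_frontier P" "q \<in> rel_frontier P" using bdry[OF ST(1)] bdry[OF ST(2)] p q by auto
        show "s *\<^sub>R (p - a) = t *\<^sub>R (q - a)" using eq p q by simp
      qed
      moreover have "\<phi> ` S \<inter> \<phi> ` T = {}"
        using inj_on_image_Int[OF inj sub] ST(3) by simp
      then have "convex hull (\<phi> ` S) \<inter> convex hull (\<phi> ` T) = {}"
        by (intro simplicial_complex_disjoint_hulls[OF sc] imageI ST indep)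
      ultimately show False using p q by blast
    qed
  qed
  have "z2_index ?X (affine_extension swap_sides) \<le> ereal (real (card B) - 1)"
  proof (rule z2_index_le_nonvanishing[where y = "\<lambda>b x. z x \<bullet> b", OF finB])
    show "continuous_map ?X euclideanreal (\<lambda>x. z x \<bullet> b)" for b
      unfolding z_def inner_sum_left inner_scaleR_left
      by (intro continuous_map_sum continuous_map_real_mult continuous_map_diff continuous_map_polyhedron_coordinate) auto
    have "z (affine_extension swap_sides x) = - z x" for x
      unfolding z_def sum_negf[symmetric] by (intro sum.cong) (auto simp: algebra_simps)
    then show "z (affine_extension swap_sides x) \<bullet> b = - (z x \<bullet> b)" for x b
      by simp
    show "\<exists>b\<in>B. z x \<bullet> b \<noteq> 0" if "x \<in> topspace ?X" for x
    proof (rule ccontr)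
      assume "\<not> ?thesis"
      \<comment> \<open>\<open>z x\<close> lies in the span of \<open>B\<close>; orthogonal to all
        of \<open>B\<close>, it is orthogonal to itself.\<close>
      then have "orthogonal (z x) (z x)"
        using zW[of x] B(3) by (intro orthogonal_to_span[of "z x" B]) (auto simp: orthogonal_def)
      then show False using z0[OF that] by (simp add: orthogonal_self)
    qed
  qed
  moreover have "real (card B) - 1 = real_of_int (aff_dim P - 1)"
  proof -
    have "real (dim W) = real_of_int (aff_dim P)" unfolding dimW[symmetric] by simp
    then show ?thesis using B(2) by simp
  qed
  ultimately show ?thesis by (simp only: complex_index_def)
qed

text \<open>A face \<open>A <+> B\<close> of the deleted join is a red-blue colouring of
  \<open>A \<union> B\<close> without monochromatic members of \<open>\<F>\<close>, and the
  remaining points are an admissible \<open>Y\<close>. So a face of largest cardinality leaves a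
  smallest \<open>Y\<close>.\<close>

lemma complex_dim_eq_cd2: "int n - 1 - complex_dim (deleted_join K) = int (cd2 n \<F>)"
proof -
  define good where "good Y \<longleftrightarrow> Y \<subseteq> {1..n} \<and>
     (\<exists>red :: nat \<Rightarrow> bool. \<forall>F\<in>\<F>. F \<inter> Y = {} \<longrightarrow> \<not> (\<forall>i\<in>F. red i) \<and> \<not> (\<forall>i\<in>F. \<not> red i))" for Y
  have cd2: "cd2 n \<F> = (LEAST k. \<exists>Y. good Y \<and> card Y = k)"
    unfolding cd2_def good_def by (rule arg_cong[where f = Least]) blast
  let ?d = "\<lambda>S :: (nat + nat) set. int (card S) - 1"
  have card: "card (A <+> B) = card (A \<union> B)" if "A \<in> K" "B \<in> K" "A \<inter> B = {}" for A B
  proof -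
    have "finite A" "finite B" using that finite_subset[of _ "{1..n}"] by (auto simp: free_complex_def)
    then show ?thesis using that by (simp add: card_Plus card_Un_disjoint)
  qed
  have fin: "finite (?d ` deleted_join K)" "?d ` deleted_join K \<noteq> {}"
    using free.finite_complex empty_free by auto
  have good_imp: "\<exists>S\<in>deleted_join K. card S = n - card Y" if Y: "good Y" for Y
  proof -
    have sub: "Y \<subseteq> {1..n}" using Y by (simp only: good_def)
    obtain red :: "nat \<Rightarrow> bool" where "\<forall>F\<in>\<F>. F \<inter> Y = {} \<longrightarrow> \<not> (\<forall>i\<in>F. red i) \<and> \<not> (\<forall>i\<in>F. \<not> red i)"
      using Y unfolding good_def by (elim conjE exE)
    then have red: "\<not> (\<forall>i\<in>F. red i) \<and> \<not> (\<forall>i\<in>F. \<not> red i)" if "F \<in> \<F>" "F \<inter> Y = {}" for F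
      using that by simp
    define A B where "A = {i \<in> {1..n} - Y. red i}" and "B = {i \<in> {1..n} - Y. \<not> red i}"
    have A: "A \<in> K"
    proof -
      have "\<not> F \<subseteq> A" if "F \<in> \<F>" for F using red[OF that] by (auto simp: A_def)
      then show ?thesis by (auto simp: free_complex_def A_def)
    qed
    have B: "B \<in> K"
    proof -
      have "\<not> F \<subseteq> B" if "F \<in> \<F>" for F using red[OF that] by (auto simp: B_def)
      then show ?thesis by (auto simp: free_complex_def B_def)
    qed
    have disj: "A \<inter> B = {}" and un: "A \<union> B = {1..n} - Y" by (auto simp: A_def B_def)
    have "card (A <+> B) = n - card Y"
      unfolding card[OF A B disj] un using sub by (simp add: card_Diff_subset finite_subset)
    moreover have "A <+> B \<in> deleted_join K" using A B disj by (simp add: deleted_join_iff)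
    ultimately show ?thesis by blast
  qed
  obtain S where S: "S \<in> deleted_join K" "complex_dim (deleted_join K) = ?d S"
    using Max_in[OF fin] unfolding complex_dim_def by blast
  define A B where "A = Inl -` S" and "B = Inr -` S"
  have AB: "A \<in> K" "B \<in> K" "A \<inter> B = {}" using S(1) by (auto simp: deleted_join_iff A_def B_def)
  then have sub: "A \<union> B \<subseteq> {1..n}" by (auto simp: free_complex_def)
  have cardS: "card S = card (A \<union> B)" using card[OF AB] by (simp add: A_def B_def Plus_vimage)
  have "good ({1..n} - (A \<union> B))"
    unfolding good_def
  proof (intro conjI exI[of _ "\<lambda>i. i \<in> A"] ballI impI)
    fix F assume F: "F \<in> \<F>" "F \<inter> ({1..n} - (A \<union> B)) = {}"
    then have "F \<subseteq> A \<union> B" using family_subset by blast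
    moreover have "\<not> F \<subseteq> A" "\<not> F \<subseteq> B" using AB F(1) by (auto simp: free_complex_def)
    ultimately show "\<not> (\<forall>i\<in>F. i \<in> A)" "\<not> (\<forall>i\<in>F. i \<notin> A)" by blast+
  qed auto
  moreover have "card ({1..n} - (A \<union> B)) = n - card S"
    unfolding cardS using sub by (subst card_Diff_subset) (auto intro: finite_subset)
  moreover have "n - card S \<le> card Y" if Y: "good Y" for Y
  proof -
    obtain T where T: "T \<in> deleted_join K" "card T = n - card Y" using good_imp[OF Y] by blast
    then have "card T \<le> card S"
      using Max_ge[OF fin(1) imageI[OF T(1)]] S(2) by (simp add: complex_dim_def)
    then show ?thesis using T(2) by simp
  qed
  ultimately have "cd2 n \<F> = n - card S"
    unfolding cd2 by (intro Least_equality) auto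
  moreover have "card S \<le> n" unfolding cardS using card_mono[OF _ sub] by simp
  ultimately show ?thesis using S(2) by simp
qed

end

text \<open>An injective colouring is proper because there are no loops, so the least number of
  colours is attained.\<close>

lemma chromatic_number_coloring:
  assumes "finite (verts G)" and loopless: "\<And>v. {v} \<notin> edges G"
  obtains c where "c ` verts G \<subseteq> {..<chromatic_number G}"
    "\<And>v w. v \<in> verts G \<Longrightarrow> w \<in> verts G \<Longrightarrow> {v, w} \<in> edges G \<Longrightarrow> c v \<noteq> c w"
proof -
  obtain f :: "'a \<Rightarrow> nat" and k where f: "f ` verts G = {i. i < k}" "inj_on f (verts G)"
    using finite_imp_inj_to_nat_seg[OF assms(1)] by blast
  have "\<exists>c :: 'a \<Rightarrow> nat. c ` verts G \<subseteq> {..<chromatic_number G} \<and>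
        (\<forall>v\<in>verts G. \<forall>w\<in>verts G. {v, w} \<in> edges G \<longrightarrow> c v \<noteq> c w)"
    unfolding chromatic_number_def
  proof (rule LeastI_ex, intro exI conjI ballI impI)
    show "f ` verts G \<subseteq> {..<k}" using f(1) by auto
    show "f v \<noteq> f w" if "v \<in> verts G" "w \<in> verts G" "{v, w} \<in> edges G" for v w
      using f(2) that loopless[of v] by (auto simp: inj_on_def)
  qed
  then show thesis using that by blast
qed

lemma (in finite_loopless_graph) complex_index_box_le_chromatic_number:
  assumes "verts G \<noteq> {}"
  shows "complex_index (box_complex G) swap_sides + 2 \<le> ereal (real (chromatic_number G))"
proof -
  obtain c where c: "c ` verts G \<subseteq> {..<chromatic_number G}"
    "\<And>v w. v \<in> verts G \<Longrightarrow> w \<in> verts G \<Longrightarrow> {v, w} \<in> edges G \<Longrightarrow> c v \<noteq> c w"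
    using chromatic_number_coloring[OF finite_verts loopless] by blast
  \<comment> \<open>A nonempty vertex set needs at least one colour, so the subtraction is
    exact.\<close>
  define m where "m = chromatic_number G - 1"
  have m: "chromatic_number G = Suc m" using c(1) assms unfolding m_def by (cases "chromatic_number G") auto
  have "complex_index (box_complex G) swap_sides \<le> ereal (real m - 1)"
    using c by (intro complex_index_box_le_coloring[of c]) (auto simp: m lessThan_Suc_atMost)
  then have "complex_index (box_complex G) swap_sides + 2 \<le> ereal (real m - 1) + 2"
    by (rule add_right_mono)
  then show ?thesis by (simp add: m)
qed

theorem theorem4p1:
  fixes n :: nat and \<F> :: "nat set set" and G :: "nat set graph" and K :: "nat set set"
  assumes "n \<ge> 1"
    and "\<F> \<subseteq> Pow {1..n}" and "\<F> \<noteq> {}" and "{} \<notin> \<F>"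
    and "G = kneser_graph \<F>"
    and "no_isolated_vertices G"
    and "K = free_complex n \<F>"
  shows "ereal (real (chromatic_number G)) \<ge> complex_index (box_complex G) swap_sides + 2 \<and>
    complex_index (box_complex G) swap_sides + 2 = complex_index (lovasz_complex G) (CN G) + 2 \<and>
    complex_index (lovasz_complex G) (CN G) + 2 \<ge> complex_index (box_complex0 G) swap_sides + 1 \<and>
    complex_index (box_complex0 G) swap_sides + 1 =
      complex_index (order_complex (deleted_join (Pow {1..n}) - deleted_join K)) ((`) swap_sides) + 1 \<and>
    complex_index (order_complex (deleted_join (Pow {1..n}) - deleted_join K)) ((`) swap_sides) + 1
      \<ge> ereal (real n) - 1 - complex_index (deleted_join K) swap_sides \<and>
    (\<forall>(d :: int) (P :: 'e::euclidean_space set) (\<phi> :: nat \<Rightarrow> 'e).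
       polytope P \<and> aff_dim P = int n - d \<and>
       inj_on \<phi> {1..n} \<and> (\<forall>i\<in>{1..n}. \<phi> i extreme_point_of P) \<and>
       (\<forall>S\<in>K. \<not> affine_dependent (\<phi> ` S) \<and> convex hull (\<phi> ` S) \<subseteq> rel_frontier P) \<and>
       simplicial_complex ((\<lambda>S. convex hull (\<phi> ` S)) ` K)
       \<longrightarrow> ereal (real n) - 1 - complex_index (deleted_join K) swap_sides \<ge> ereal (real_of_int d)) \<and>
    ereal (real n) - 1 - complex_index (deleted_join K) swap_sides
      \<ge> ereal (real_of_int (int n - 1 - complex_dim (deleted_join K))) \<and>
    int n - 1 - complex_dim (deleted_join K) = int (cd2 n \<F>)"
proof -
  interpret set_family n \<F> using assms by unfold_locales
  define \<kappa> where "\<kappa> = complex_index (deleted_join K) swap_sides"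
  have \<kappa>: "-1 \<le> \<kappa>" by (simp add: \<kappa>_def complex_index_def z2_index_ge_minus_1)
  \<comment> \<open>The lower bound -1 and the assumed upper bound make \<open>\<kappa>\<close> a
    real number, where the inequality can be rearranged.\<close>
  have bound: "ereal (real_of_int e) \<le> ereal (real n) - 1 - \<kappa>" if "\<kappa> \<le> ereal (real_of_int (int n - 1 - e))" for e
    using that \<kappa> by (cases \<kappa>) (auto simp: one_ereal_def)
  let ?\<delta> = "complex_index (order_complex (deleted_join (Pow {1..n}) - deleted_join K)) ((`) swap_sides)"
  have chi: "complex_index (box_complex G) swap_sides + 2 \<le> ereal (real (chromatic_number G))"
    using graph.complex_index_box_le_chromatic_number assms(3) by (simp add: assms(5) kneser_graph_def)
  have lovasz: "complex_index (box_complex G) swap_sides = complex_index (lovasz_complex G) (CN G)"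
    unfolding assms(5) by (rule graph.complex_index_box_eq_lovasz)
  have "complex_index (box_complex0 G) swap_sides + 1 \<le> complex_index (box_complex G) swap_sides + 1 + 1"
    unfolding assms(5) by (intro add_right_mono graph.complex_index_box0_le)
  then have box0: "complex_index (box_complex0 G) swap_sides + 1 \<le> complex_index (lovasz_complex G) (CN G) + 2"
    by (simp add: lovasz add.assoc)
  have nonfaces: "complex_index (box_complex0 G) swap_sides = ?\<delta>"
    unfolding assms(5,7) by (intro antisym complex_index_box0_le_nonfaces complex_index_nonfaces_le_box0)
  have "-1 \<le> ?\<delta>" by (simp add: complex_index_def z2_index_ge_minus_1)
  moreover have "ereal (real n - 1) \<le> \<kappa> + ?\<delta> + 1"
    unfolding \<kappa>_def assms(7) by (rule Sarkaria_inequality[OF assms(1)])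
  \<comment> \<open>Both indices are at least -1, so no opposite infinities meet; for infinite
    \<open>\<kappa>\<close> the left side is negative infinity.\<close>
  ultimately have sarkaria: "ereal (real n) - 1 - \<kappa> \<le> ?\<delta> + 1"
    using \<kappa> by (cases \<kappa>; cases ?\<delta>) (auto simp: one_ereal_def)
  have polytope: "\<forall>d (P :: 'e set) \<phi>.
       polytope P \<and> aff_dim P = int n - d \<and>
       inj_on \<phi> {1..n} \<and> (\<forall>i\<in>{1..n}. \<phi> i extreme_point_of P) \<and>
       (\<forall>S\<in>K. \<not> affine_dependent (\<phi> ` S) \<and> convex hull (\<phi> ` S) \<subseteq> rel_frontier P) \<and>
       simplicial_complex ((\<lambda>S. convex hull (\<phi> ` S)) ` K)
       \<longrightarrow> ereal (real_of_int d) \<le> ereal (real n) - 1 - \<kappa>"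
  proof (intro allI impI, elim conjE, rule bound)
    fix d and P :: "'e set" and \<phi>
    assume P: "polytope P" "aff_dim P = int n - d" "inj_on \<phi> {1..n}" "\<forall>i\<in>{1..n}. \<phi> i extreme_point_of P"
      "\<forall>S\<in>K. \<not> affine_dependent (\<phi> ` S) \<and> convex hull (\<phi> ` S) \<subseteq> rel_frontier P"
      "simplicial_complex ((\<lambda>S. convex hull (\<phi> ` S)) ` K)"
    have "\<kappa> \<le> ereal (real_of_int (aff_dim P - 1))"
      unfolding \<kappa>_def assms(7)
      by (rule complex_index_free_le_polytope[of P \<phi>]) (use P assms in \<open>auto simp: extreme_point_of_def\<close>)
    then show "\<kappa> \<le> ereal (real_of_int (int n - 1 - d))"
      by (simp add: P(2) algebra_simps)
  qed
  have dim: "ereal (real_of_int (int n - 1 - complex_dim (deleted_join K))) \<le> ereal (real n) - 1 - \<kappa>"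
  proof (rule bound)
    have "\<kappa> \<le> ereal (real_of_int (complex_dim (deleted_join K)))"
      unfolding \<kappa>_def
    proof (rule complex_index_deleted_join_le_dim[of "{1..n}"])
      show "S \<subseteq> {1..n}" if "S \<in> K" for S using that assms(7) by (simp add: free_complex_def)
      show "T \<in> K" if "S \<in> K" "T \<subseteq> S" for S T
        using that free_complex_down_closed unfolding assms(7) by blast
      show "deleted_join K \<noteq> {}" using empty_free assms(7) by auto
    qed simp
    then show "\<kappa> \<le> ereal (real_of_int (int n - 1 - (int n - 1 - complex_dim (deleted_join K))))" by simp
  qed
  have cd2: "int n - 1 - complex_dim (deleted_join K) = int (cd2 n \<F>)"
    unfolding assms(7) by (rule complex_dim_eq_cd2)
  show ?thesis
    unfolding \<kappa>_def[symmetric] lovasz nonfaces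
    by (intro conjI refl) (rule chi[unfolded lovasz] box0[unfolded nonfaces] sarkaria polytope dim cd2)+
qed

end
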